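(* Let $R>1$. For every scalar or vector-valued $w\in H^1_0(\Omega_R)$, $$\|w\|_{L^4(\Omega_R)}^2\le\frac1{\mu_0}\sqrt{\frac{2}{3\pi}(R^2-1)}\;\|\nabla w\|_{L^2(\Omega_R)}^2 .$$ Moreover, $$\mu_0\sqrt{\frac{3\pi}{2(R^2-1)}}\le\mathcal S_4\le 24\sqrt{5\pi}\,\frac{\big[(R^2+1)\log R+1-R^2\big](R^2-1)\log R}{\sqrt{\kappa_1}},$$ where (writing $L=\log R$) $\kappa_1=-1080+5400R^2-10800R^4+10800R^6-5400R^8+1080R^{10}-2025L+6075R^2L-4050R^4L-4050R^6L+6075R^8L-2025R^{10}L-1700L^2+3400R^2L^2-1700R^4L^2+1700R^6L^2-3400R^8L^2+1700R^{10}L^2-750(1-R^2)L^3+750R^8L^3-750R^{10}L^3-144L^4+144R^{10}L^4 .$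
   Context: $\Omega_R=\{\xi\in\mathbb{R}^2:1<|\xi|<R\}$. $\mathcal S_4=\min_{v\in H^1_0(\Omega_R)\setminus\{0\}}\|\nabla v\|_{L^2(\Omega_R)}^2/\|v\|_{L^4(\Omega_R)}^2$. $\mu_0\approx2.40483$ is the first positive zero of the Bessel function $J_0$. For vector fields $w=(w_1,w_2)$, $\|w\|_{L^p}$ is the $L^p$ norm of $|w|$ and $\|\nabla w\|_{L^2}^2=\|\nabla w_1\|_{L^2}^2+\|\nabla w_2\|_{L^2}^2$. *)

theory Defs
  imports "HOL-Analysis.Analysis"
begin

definition besselJ0 :: "real \<Rightarrow> real" where
  "besselJ0 x = (\<Sum>k. (-1) ^ k * (x / 2) ^ (2 * k) / (fact k) ^ 2)"

definition mu0 :: real where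
  "mu0 = Inf {x. 0 < x \<and> besselJ0 x = 0}"

definition Omega :: "real \<Rightarrow> (real^2) set" where
  "Omega R = {x. 1 < norm x \<and> norm x < R}"

text \<open>H^1_0(Omega_R): w with weak gradient g (g i = partial derivative in direction i,
  i ranging over the standard basis of R^2) lies in the closure, in the H^1 norm, of
  C^1 functions with compact support in Omega_R.\<close>
definition H10 :: "real \<Rightarrow> (real^2 \<Rightarrow> 'b::euclidean_space) \<Rightarrow> (real^2 \<Rightarrow> real^2 \<Rightarrow> 'b) \<Rightarrow> bool" where
  "H10 R w g \<longleftrightarrow>
     w \<in> borel_measurable lebesgue \<and> (\<forall>i\<in>Basis. g i \<in> borel_measurable lebesgue) \<and>
     (\<exists>(\<phi>::nat \<Rightarrow> real^2 \<Rightarrow> 'b) (D\<phi>::nat \<Rightarrow> real^2 \<Rightarrow> real^2 \<Rightarrow> 'b).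
        (\<forall>n x. (\<phi> n has_derivative D\<phi> n x) (at x)) \<and>
        (\<forall>n. \<forall>i\<in>Basis. continuous_on UNIV (\<lambda>x. D\<phi> n x i)) \<and>
        (\<forall>n. compact (closure {x. \<phi> n x \<noteq> 0}) \<and> closure {x. \<phi> n x \<noteq> 0} \<subseteq> Omega R) \<and>
        ((\<lambda>n. \<integral>\<^sup>+ x \<in> Omega R. ennreal ((norm (\<phi> n x - w x))\<^sup>2) \<partial>lebesgue) \<longlonglongrightarrow> 0) \<and>
        (\<forall>i\<in>Basis. (\<lambda>n. \<integral>\<^sup>+ x \<in> Omega R. ennreal ((norm (D\<phi> n x i - g i x))\<^sup>2) \<partial>lebesgue) \<longlonglongrightarrow> 0))"

definition grad_sq :: "real \<Rightarrow> (real^2 \<Rightarrow> real^2 \<Rightarrow> 'b::euclidean_space) \<Rightarrow> real" where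
  "grad_sq R g = (\<Sum>i\<in>(Basis :: (real^2) set). LINT x : Omega R | lebesgue. (norm (g i x))\<^sup>2)"

definition L4_sq :: "real \<Rightarrow> (real^2 \<Rightarrow> 'b::euclidean_space) \<Rightarrow> real" where
  "L4_sq R w = sqrt (LINT x : Omega R | lebesgue. (norm (w x)) ^ 4)"

text \<open>Sharp Sobolev constant S_4 (the minimum, written as infimum) over nonzero
  scalar H^1_0 functions; nonzero means not a.e. zero on Omega_R.\<close>
definition S4 :: "real \<Rightarrow> real" where
  "S4 R = Inf {grad_sq R g / L4_sq R v | (v :: real^2 \<Rightarrow> real) g.
                 H10 R v g \<and> \<not> (AE x in lebesgue. x \<in> Omega R \<longrightarrow> v x = 0)}"

definition kappa1 :: "real \<Rightarrow> real" where
  "kappa1 R = (let L = ln R in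
     -1080 + 5400*R^2 - 10800*R^4 + 10800*R^6 - 5400*R^8 + 1080*R^10
     - 2025*L + 6075*R^2*L - 4050*R^4*L - 4050*R^6*L + 6075*R^8*L - 2025*R^10*L
     - 1700*L^2 + 3400*R^2*L^2 - 1700*R^4*L^2 + 1700*R^6*L^2 - 3400*R^8*L^2 + 1700*R^10*L^2
     - 750*(1 - R^2)*L^3 + 750*R^8*L^3 - 750*R^10*L^3 - 144*L^4 + 144*R^10*L^4)"

end

theory Submission
  imports Defs
begin

text \<open>
  By density and Fatou's lemma it suffices to treat \<open>C\<^sup>1\<close> functions \<open>u\<close> compactly supported in
  the annulus, for which two inequalities are combined.

  \<^item> A planar inequality with the constant \<open>1 / (3 \<surd>3) \<le> 2 / (3 \<pi>)\<close>:
    \<open>\<integral>|u|\<^sup>4 \<le> 1 / (3 \<surd>3) \<integral>|u|\<^sup>2 \<integral>|\<nabla>u|\<^sup>2\<close>. On a horizontal line, with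
    \<open>m = \<integral>|u|\<^sup>2 dx\<close> and \<open>P\<close> the primitive of \<open>|u|\<^sup>2\<close>, integrate
    \<open>\<integral>|u|\<^sup>4 = - \<integral>(P - m/2) (|u|\<^sup>2)'\<close> and use Cauchy-Schwarz to get
    \<open>(\<integral>|u|\<^sup>4 dx)\<^sup>2 \<le> m\<^sup>3/3 \<integral>|u\<^sub>x|\<^sup>2 dx\<close>. As a function of \<open>y\<close>, \<open>m\<close> satisfies
    \<open>m'\<^sup>2 \<le> 4 m \<integral>|u\<^sub>y|\<^sup>2 dx\<close>, and \<open>\<integral>m\<^sup>3 dy\<close> is bounded by a Poincare inequality on \<open>[0,1]\<close> in
    the variable \<open>p = \<integral>\<^sub>-\<^sub>\<infinity>\<^sup>y m / \<integral>m\<close>; there the eigenvalue \<open>9 < \<pi>\<^sup>2\<close>, with the positive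
    supersolution \<open>cos (3 (p - 1/2))\<close>, is good enough and avoids singularities at the ends.

  \<^item> A Faber-Krahn inequality \<open>\<mu>\<^sub>0\<^sup>2 / (R\<^sup>2 - 1) \<integral>|u|\<^sup>2 \<le> \<integral>|\<nabla>u|\<^sup>2\<close>. No rearrangement is needed:
    the substitution \<open>\<rho>\<^sup>2 = r\<^sup>2 - 1\<close> preserves area, does not increase the radial energy, and maps
    the annulus to a disc, where \<open>J\<^sub>0(\<mu>\<^sub>0 \<rho> / \<surd>(R\<^sup>2 - 1))\<close> is a positive eigenfunction.

  The upper bound for \<open>S4\<close> is the Rayleigh quotient of (a multiple of) the torsion function
  \<open>(R\<^sup>2 - 1) ln |x| - (|x|\<^sup>2 - 1) ln R\<close>.
\<close>

section \<open>One-dimensional inequalities: a single slice and the profile of slices\<close>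

text \<open>Pointwise AM-GM gives 2 t f <= t^2 g + h for every real t; integrate, then optimise over
  t. Only the integrals of \<open>f\<close>, \<open>g\<close>, \<open>h\<close> themselves occur, no
  square roots.\<close>

lemma integral_Cauchy_Schwarz_pointwise:
  fixes f g h :: "'a::euclidean_space \<Rightarrow> real"
  assumes f: "f integrable_on S" and g: "g integrable_on S" and h: "h integrable_on S"
    and g0: "\<And>x. x \<in> S \<Longrightarrow> 0 \<le> g x" and h0: "\<And>x. x \<in> S \<Longrightarrow> 0 \<le> h x"
    and le: "\<And>x. x \<in> S \<Longrightarrow> (f x)\<^sup>2 \<le> g x * h x"
  shows "(integral S f)\<^sup>2 \<le> integral S g * integral S h"
proof -
  define F G H where "F = integral S f" and "G = integral S g" and "H = integral S h"
  have G0: "0 \<le> G" and H0: "0 \<le> H"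
    unfolding G_def H_def using g0 h0 by (auto intro!: integral_nonneg g h)
  have quad: "2 * t * F \<le> t\<^sup>2 * G + H" for t
  proof -
    have pw: "2 * t * f x \<le> t\<^sup>2 * g x + h x" if x: "x \<in> S" for x
    proof -
      have "(2 * t * f x)\<^sup>2 \<le> 4 * (t\<^sup>2 * g x) * h x"
        using mult_left_mono[OF le[OF x], of "4 * t\<^sup>2"] by (simp add: power_mult_distrib algebra_simps)
      also have "\<dots> \<le> (t\<^sup>2 * g x + h x)\<^sup>2"
        using sum_squares_ge_zero[of "t\<^sup>2 * g x - h x" 0] by (simp add: power2_eq_square algebra_simps)
      finally show ?thesis
        using g0[OF x] h0[OF x] by (meson abs_le_square_iff abs_le_D1 add_nonneg_nonneg
            mult_nonneg_nonneg power2_le_imp_le power2_abs zero_le_power2)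
    qed
    have fi: "(\<lambda>x. 2 * t * f x) integrable_on S" and gi: "(\<lambda>x. t\<^sup>2 * g x) integrable_on S"
      using integrable_cmul[OF f, of "2 * t"] integrable_cmul[OF g, of "t\<^sup>2"] by simp_all
    have "integral S (\<lambda>x. 2 * t * f x) \<le> integral S (\<lambda>x. t\<^sup>2 * g x + h x)"
      using pw fi gi h by (intro integral_le integrable_add) auto
    then show ?thesis
      using gi h by (simp add: integral_add F_def G_def H_def)
  qed
  show ?thesis unfolding F_def[symmetric] G_def[symmetric] H_def[symmetric]
  proof (cases "G = 0")
    case True
    show "F\<^sup>2 \<le> G * H"
    proof (rule ccontr)
      assume "\<not> F\<^sup>2 \<le> G * H"
      then have "F \<noteq> 0" using True by auto
      \<comment> \<open>If G = 0, the bound 2 t F <= H holds for all t only when F = 0; this t would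
        give 2 (H + 1) <= H.\<close>
      then show False using quad[of "(H + 1) / F"] True H0 by simp
    qed
  next
    case False
    then have "G > 0" using G0 by simp
    \<comment> \<open>\<open>F / G\<close> minimises t^2 G - 2 t F.\<close>
    then show "F\<^sup>2 \<le> G * H" using quad[of "F / G"]
      by (simp add: field_simps power2_eq_square)
  qed
qed

lemma integral_derivative_eq_0:
  fixes F f :: "real \<Rightarrow> real"
  assumes "a \<le> b" and "\<And>x. (F has_real_derivative f x) (at x)" and "F a = 0" "F b = 0"
  shows "(f has_integral 0) {a..b}"
  using fundamental_theorem_of_calculus[of a b F f] assms
  by (auto simp: has_real_derivative_iff_has_vector_derivative has_vector_derivative_at_within)

text \<open>Here \<open>s\<close> stands for |u|^2 on a line and \<open>A\<close> for |u_x|^2, so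
  \<open>d\<close> is twice the inner product of u and u_x, and \<open>le\<close> is Cauchy-Schwarz
  for it.\<close>

lemma quartic_slice:
  fixes s d A :: "real \<Rightarrow> real"
  assumes ab: "a \<le> b"
    and s: "\<And>x. (s has_real_derivative d x) (at x)" and d: "continuous_on {a..b} d"
    and A: "continuous_on {a..b} A" and s0: "\<And>x. 0 \<le> s x" and A0: "\<And>x. 0 \<le> A x"
    and le: "\<And>x. (d x)\<^sup>2 \<le> 4 * s x * A x" and sa: "s a = 0" "s b = 0"
  shows "(integral {a..b} (\<lambda>x. (s x)\<^sup>2))\<^sup>2 \<le> (integral {a..b} s) ^ 3 / 3 * integral {a..b} A"
proof -
  define m where "m = integral {a..b} s"
  define P where "P x = integral {a..x} s" for x
  have sc: "continuous_on S s" for S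
    using s DERIV_isCont continuous_at_imp_continuous_on by blast
  have P: "(P has_real_derivative s x) (at x within {a..b})" if "x \<in> {a..b}" for x
    unfolding P_def using integral_has_real_derivative[OF sc that] .
  have Pa: "P a = 0" "P b = m" by (auto simp: P_def m_def)
  have Pc: "continuous_on {a..b} P"
    using P DERIV_continuous continuous_on_eq_continuous_within by blast
  \<comment> \<open>The boundary terms vanish with \<open>s\<close>. Subtracting m/2 is the best
    constant c: 4 times the integral of (P - c)^2 s is 4/3 ((m - c)^3 + c^3), smallest at c = m/2
    with value m^3/3.\<close>
  have "((\<lambda>x. s x * s x + d x * (P x - m / 2)) has_integral
          (s b * (P b - m/2) - s a * (P a - m/2))) {a..b}"
  proof (rule fundamental_theorem_of_calculus[OF ab])
    fix x assume x: "x \<in> {a..b}"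
    have "((\<lambda>x. s x * (P x - m / 2)) has_real_derivative (s x * s x + d x * (P x - m / 2))) (at x within {a..b})"
      by (rule derivative_eq_intros DERIV_subset[OF s] P[OF x] | simp)+
    then show "((\<lambda>x. s x * (P x - m / 2)) has_vector_derivative (s x * s x + d x * (P x - m / 2))) (at x within {a..b})"
      by (simp add: has_real_derivative_iff_has_vector_derivative)
  qed
  then have 1: "((\<lambda>x. s x * s x + d x * (P x - m / 2)) has_integral 0) {a..b}" by (simp add: sa)
  have i1: "(\<lambda>x. s x * s x) integrable_on {a..b}"
    by (intro integrable_continuous_real continuous_intros sc)
  have i2: "(\<lambda>x. d x * (P x - m / 2)) integrable_on {a..b}"
    by (intro integrable_continuous_real continuous_intros d Pc)
  have e1: "integral {a..b} (\<lambda>x. (s x)\<^sup>2) = - integral {a..b} (\<lambda>x. d x * (P x - m / 2))"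
    using integral_unique[OF 1] by (simp add: integral_add i1 i2 power2_eq_square)
  have "((\<lambda>x. 4 * (P x - m / 2)\<^sup>2 * s x) has_integral
          (4 / 3 * (P b - m/2)^3 - 4 / 3 * (P a - m/2)^3)) {a..b}"
  proof (rule fundamental_theorem_of_calculus[OF ab])
    fix x assume x: "x \<in> {a..b}"
    have "((\<lambda>x. 4 / 3 * (P x - m / 2)^3) has_real_derivative (4 * (P x - m / 2)\<^sup>2 * s x)) (at x within {a..b})"
      by (rule derivative_eq_intros P[OF x] | simp)+
    then show "((\<lambda>x. 4 / 3 * (P x - m / 2)^3) has_vector_derivative (4 * (P x - m / 2)\<^sup>2 * s x)) (at x within {a..b})"
      by (simp add: has_real_derivative_iff_has_vector_derivative)
  qed
  then have 2: "((\<lambda>x. 4 * (P x - m / 2)\<^sup>2 * s x) has_integral m ^ 3 / 3) {a..b}"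
    by (simp add: Pa power3_eq_cube field_simps)
  have "(integral {a..b} (\<lambda>x. d x * (P x - m / 2)))\<^sup>2 \<le>
     integral {a..b} (\<lambda>x. 4 * (P x - m / 2)\<^sup>2 * s x) * integral {a..b} A"
  proof (rule integral_Cauchy_Schwarz_pointwise)
    fix x show "(d x * (P x - m / 2))\<^sup>2 \<le> 4 * (P x - m / 2)\<^sup>2 * s x * A x"
      using mult_right_mono[OF le[of x], of "(P x - m / 2)\<^sup>2"]
      by (simp add: power_mult_distrib mult_ac)
  qed (use 2 i2 s0 A0 integrable_continuous_real[OF A] in auto)
  then show ?thesis unfolding integral_unique[OF 2] e1 power2_minus m_def[symmetric] .
qed

text \<open>Write M for the integral of m and p for its normalised primitive. The integral of m^3 dy
  is M times that of m^2 dp, and \<open>le\<close> bounds the integral of (dm/dp)^2 dp by 4 M times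
  that of B. The claim is thus a Poincare inequality on [0,1] with constant 9 for functions
  vanishing at both ends; the computation stays in y, so zeros of m cause no trouble.\<close>

lemma sextic_profile:
  fixes m d B :: "real \<Rightarrow> real"
  assumes ab: "a \<le> b"
    and m: "\<And>y. y \<in> {a..b} \<Longrightarrow> (m has_real_derivative d y) (at y within {a..b})"
    and d: "continuous_on {a..b} d"
    and B: "continuous_on {a..b} B" and m0: "\<And>y. 0 \<le> m y" and B0: "\<And>y. 0 \<le> B y"
    and le: "\<And>y. (d y)\<^sup>2 \<le> 4 * m y * B y" and ma: "m a = 0" "m b = 0"
  shows "integral {a..b} (\<lambda>y. (m y) ^ 3) \<le> 4 / 9 * (integral {a..b} m)\<^sup>2 * integral {a..b} B"
proof -
  define M where "M = integral {a..b} m"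
  have mc: "continuous_on {a..b} m"
    using m DERIV_continuous continuous_on_eq_continuous_within by blast
  have mi: "m integrable_on {a..b}" using mc by (rule integrable_continuous_real)
  have M0: "M \<ge> 0" unfolding M_def using mi m0 by (intro integral_nonneg) auto
  show ?thesis
  proof (cases "M = 0")
    case True
    \<comment> \<open>The variable p needs M > 0. If M = 0, continuity and nonnegativity make m
      vanish identically.\<close>
    have "m y = 0" if "y \<in> {a..b}" for y
    proof -
      have "(m has_integral 0) (cbox a b)"
        using mi True M_def by (simp add: has_integral_integral)
      then show ?thesis
        using has_integral_0_cbox_imp_0[of a b m y] mc m0 that ma
        by (cases "a = b") (auto simp: box_real)
    qed
    then have "integral {a..b} (\<lambda>y. (m y) ^ 3) = integral {a..b} (\<lambda>y. 0)"
      by (intro integral_cong) simp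
    then show ?thesis using integral_nonneg[OF integrable_continuous_real[OF B]] B0 by simp
  next
    case False
    then have Mp: "M > 0" using M0 by simp
    define P where "P y = integral {a..y} m / M" for y
    \<comment> \<open>The logarithmic derivative in p of cos (3 (p - 1/2)); it solves dq/dp = -(9 +
      q^2).\<close>
    define q where "q y = - 3 * tan (3 * (P y - 1/2))" for y
    have P: "(P has_real_derivative m y / M) (at y within {a..b})" if "y \<in> {a..b}" for y
      unfolding P_def using integral_has_real_derivative[OF mc that]
      by (rule DERIV_cdivide)
    have P01: "0 \<le> P y \<and> P y \<le> 1" if "y \<in> {a..b}" for y
    proof -
      have i: "m integrable_on {a..y}" using that by (intro integrable_subinterval_real[OF mi]) auto
      have "integral {a..y} m \<ge> 0" using i m0 by (intro integral_nonneg) auto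
      moreover have "integral {a..y} m \<le> M"
        unfolding M_def using i mi m0 that by (intro integral_subset_le) auto
      ultimately show ?thesis using Mp by (simp add: P_def)
    qed
    \<comment> \<open>The argument lies in [-3/2, 3/2], inside (-pi/2, pi/2) because 3 < pi, so
      \<open>q\<close> is regular up to both ends.\<close>
    have cos: "cos (3 * (P y - 1/2)) \<noteq> 0" if "y \<in> {a..b}" for y
      using P01[OF that] pi_gt3 by (intro less_imp_neq[THEN not_sym] cos_gt_zero_pi) (auto simp: field_simps)
    have q: "(q has_real_derivative (- (9 + (q y)\<^sup>2) * (m y / M))) (at y within {a..b})"
      if "y \<in> {a..b}" for y
    proof -
      have "(tan has_real_derivative (inverse ((cos (3 * (P y - 1/2)))\<^sup>2))) (at (3 * (P y - 1/2)))"
        using DERIV_tan[OF cos[OF that]] .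
      then have "((\<lambda>y. tan (3 * (P y - 1/2))) has_real_derivative
          (inverse ((cos (3 * (P y - 1/2)))\<^sup>2) * (3 * (m y / M)))) (at y within {a..b})"
        by (rule DERIV_chain2) (rule derivative_eq_intros P[OF that] | simp)+
      then have "(q has_real_derivative (-3) *
          (inverse ((cos (3 * (P y - 1/2)))\<^sup>2) * (3 * (m y / M)))) (at y within {a..b})"
        unfolding q_def by (rule DERIV_cmult)
      moreover have "inverse ((cos (3 * (P y - 1/2)))\<^sup>2) = 1 + (tan (3 * (P y - 1/2)))\<^sup>2"
        using tan_sec[OF cos[OF that]] by (simp add: power_inverse)
      ultimately show ?thesis
        by (simp add: q_def power_mult_distrib algebra_simps add_divide_distrib)
    qed
    have qc: "continuous_on {a..b} q"
      using q DERIV_continuous continuous_on_eq_continuous_within by blast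
    \<comment> \<open>The derivative of m^2 q, whose integral is zero because m vanishes at both
      ends.\<close>
    have "((\<lambda>y. 2 * m y * d y * q y - (9 + (q y)\<^sup>2) * (m y)^3 / M) has_integral
            ((m b)\<^sup>2 * q b - (m a)\<^sup>2 * q a)) {a..b}"
    proof (rule fundamental_theorem_of_calculus[OF ab])
      fix y assume y: "y \<in> {a..b}"
      have "((\<lambda>y. (m y)\<^sup>2 * q y) has_real_derivative
          (2 * m y * d y * q y - (9 + (q y)\<^sup>2) * (m y)^3 / M)) (at y within {a..b})"
        by (rule derivative_eq_intros m[OF y] q[OF y] refl | simp add: power3_eq_cube power2_eq_square algebra_simps add_divide_distrib)+
      then show "((\<lambda>y. (m y)\<^sup>2 * q y) has_vector_derivative
          (2 * m y * d y * q y - (9 + (q y)\<^sup>2) * (m y)^3 / M)) (at y within {a..b})"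
        by (simp add: has_real_derivative_iff_has_vector_derivative)
    qed
    then have 0: "((\<lambda>y. 2 * m y * d y * q y - (9 + (q y)\<^sup>2) * (m y)^3 / M) has_integral 0) {a..b}"
      by (simp add: ma)
    \<comment> \<open>The left-hand term z = 2 m d q satisfies z^2 <= 4 (4 M B) (q^2 m^3 / M), so z
      is at most the sum of the two bracketed factors, and the terms with q^2 cancel.\<close>
    have pw: "2 * m y * d y * q y - (9 + (q y)\<^sup>2) * (m y)^3 / M
        \<le> 4 * M * B y - 9 / M * (m y)^3" for y
    proof -
      define z where "z = 2 * m y * d y * q y"
      define g where "g = 4 * M * B y"
      define h where "h = (q y)\<^sup>2 * (m y)^3 / M"
      have "z\<^sup>2 \<le> 4 * g * h"
      proof -
        have "z\<^sup>2 = (2 * m y * q y)\<^sup>2 * (d y)\<^sup>2" by (simp add: z_def power2_eq_square)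
        also have "\<dots> \<le> (2 * m y * q y)\<^sup>2 * (4 * m y * B y)" by (intro mult_left_mono le) simp
        also have "\<dots> = 4 * g * h" using Mp
          by (simp add: g_def h_def power2_eq_square power3_eq_cube field_simps)
        finally show ?thesis .
      qed
      also have "\<dots> \<le> (g + h)\<^sup>2"
        using sum_squares_ge_zero[of "g - h" 0] by (simp add: power2_eq_square algebra_simps)
      finally have "z\<^sup>2 \<le> (g + h)\<^sup>2" .
      moreover have "g + h \<ge> 0" using Mp m0[of y] B0[of y] by (auto simp: g_def h_def)
      ultimately have "z \<le> g + h" by (rule power2_le_imp_le)
      then show ?thesis by (simp add: z_def g_def h_def algebra_simps add_divide_distrib)
    qed
    have i1: "(\<lambda>y. 4 * M * B y) integrable_on {a..b}" "(\<lambda>y. 9 / M * (m y)^3) integrable_on {a..b}"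
      by (intro integrable_continuous_real continuous_intros B mc)+
    have "0 \<le> integral {a..b} (\<lambda>y. 4 * M * B y - 9 / M * (m y)^3)"
      using integral_le[OF has_integral_integrable[OF 0] integrable_diff[OF i1]] pw integral_unique[OF 0]
      by simp
    also have "\<dots> = 4 * M * integral {a..b} B - 9 / M * integral {a..b} (\<lambda>y. (m y)^3)"
      using i1 by (simp add: integral_diff)
    finally show ?thesis using Mp unfolding M_def[symmetric] by (simp add: field_simps power2_eq_square)
  qed
qed

subsection \<open>Integration over the plane\<close>

text \<open>For s = |u|^2, A = |u_x|^2, B = |u_y|^2: Cauchy-Schwarz in y is applied to the slice
  inequality, and the resulting integral of m^3 is estimated by the profile inequality. The constant
  is 4/27 = 1/3 * 4/9.\<close>

lemma planar_Gagliardo_Nirenberg: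
  fixes s sx sy A B :: "real \<Rightarrow> real \<Rightarrow> real" and a :: real
  defines "J \<equiv> \<lambda>f. integral {-a..a} (\<lambda>y. integral {-a..a} (\<lambda>x. f x y))"
  assumes a: "0 \<le> a"
    and sx: "\<And>x y. ((\<lambda>x. s x y) has_real_derivative sx x y) (at x)"
    and sy: "\<And>x y. ((\<lambda>y. s x y) has_real_derivative sy x y) (at y)"
    and c: "continuous_on UNIV (\<lambda>p. s (fst p) (snd p))"
      "continuous_on UNIV (\<lambda>p. sx (fst p) (snd p))" "continuous_on UNIV (\<lambda>p. sy (fst p) (snd p))"
      "continuous_on UNIV (\<lambda>p. A (fst p) (snd p))" "continuous_on UNIV (\<lambda>p. B (fst p) (snd p))"
    and nonneg: "\<And>x y. 0 \<le> s x y" "\<And>x y. 0 \<le> A x y" "\<And>x y. 0 \<le> B x y"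
    and lex: "\<And>x y. (sx x y)\<^sup>2 \<le> 4 * s x y * A x y"
    and ley: "\<And>x y. (sy x y)\<^sup>2 \<le> 4 * s x y * B x y"
    and zero: "\<And>x y. \<bar>x\<bar> \<ge> a \<or> \<bar>y\<bar> \<ge> a \<Longrightarrow> s x y = 0"
  shows "(J (\<lambda>x y. (s x y)\<^sup>2))\<^sup>2 \<le> 4 / 27 * (J s)\<^sup>2 * (J A * J B)"
proof -
  have cf: "continuous_on S (\<lambda>z. f (g z) (h z))"
    if "continuous_on UNIV (\<lambda>p. f (fst p) (snd p))" "continuous_on S g" "continuous_on S h"
    for f :: "real \<Rightarrow> real \<Rightarrow> real" and g h :: "'z::topological_space \<Rightarrow> real" and S
    using continuous_on_compose2[OF that(1) continuous_on_Pair[OF that(2,3)]] by simp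
  have slice: "continuous_on S (\<lambda>x. f x y)" "continuous_on S (f x)"
    if "continuous_on UNIV (\<lambda>p. f (fst p) (snd p))" for f :: "real \<Rightarrow> real \<Rightarrow> real" and S x y
    using cf[OF that, of S "\<lambda>x. x" "\<lambda>_. y"] cf[OF that, of S "\<lambda>_. x" "\<lambda>x. x"] by auto
  have par: "continuous_on S (\<lambda>y. integral {-a..a} (\<lambda>x. f x y))"
    if "continuous_on UNIV (\<lambda>p. f (fst p) (snd p))" for f :: "real \<Rightarrow> real \<Rightarrow> real" and S
    unfolding box_real[symmetric]
    by (rule integral_continuous_on_param)
      (auto simp: case_prod_unfold intro!: cf[OF that] continuous_intros)
  have par_i: "(\<lambda>x. f x y) integrable_on {-a..a}"
    "(\<lambda>y. integral {-a..a} (\<lambda>x. f x y)) integrable_on {-a..a}"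
    if "continuous_on UNIV (\<lambda>p. f (fst p) (snd p))" for f :: "real \<Rightarrow> real \<Rightarrow> real" and y
    by (intro integrable_continuous_real slice par that)+
  define m where "m y = integral {-a..a} (\<lambda>x. s x y)" for y
  define d where "d y = integral {-a..a} (\<lambda>x. sy x y)" for y
  have m0: "0 \<le> m y" for y
    unfolding m_def by (intro integral_nonneg par_i c nonneg)
  have c2: "continuous_on UNIV (\<lambda>p. (s (fst p) (snd p))\<^sup>2)" by (intro continuous_intros c)
  have m: "(m has_real_derivative d y) (at y)" for y
  proof -
    have "((\<lambda>y. integral (cbox (-a) a) (\<lambda>x. s x y)) has_real_derivative
       integral (cbox (-a) a) (\<lambda>x. sy x y)) (at y within UNIV)"
      by (rule leibniz_rule_field_derivative[where f="\<lambda>y x. s x y"])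
        (auto simp: case_prod_unfold sy intro!: cf[OF c(3)] continuous_intros par_i c)
    then show ?thesis by (simp add: m_def[abs_def] d_def)
  qed
  have "integral {-a..a} (\<lambda>y. (m y) ^ 3) \<le>
      4 / 9 * (integral {-a..a} m)\<^sup>2 * integral {-a..a} (\<lambda>y. integral {-a..a} (\<lambda>x. B x y))"
  proof (rule sextic_profile)
    fix y
    show "(m has_real_derivative d y) (at y within {-a..a})"
      using m by (rule DERIV_subset) simp
    \<comment> \<open>The slice mass inherits the slope condition \<open>ley\<close> by
      Cauchy-Schwarz in x.\<close>
    show "(d y)\<^sup>2 \<le> 4 * m y * integral {-a..a} (\<lambda>x. B x y)"
      using integral_Cauchy_Schwarz_pointwise[of "\<lambda>x. sy x y" "{-a..a}" "\<lambda>x. 4 * s x y" "\<lambda>x. B x y"]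
        ley nonneg par_i(1)[OF c(1)] par_i(1)[OF c(3)] par_i(1)[OF c(5)]
        integrable_cmul[OF par_i(1)[OF c(1)], of y 4]
      by (simp add: m_def d_def)
    show "0 \<le> integral {-a..a} (\<lambda>x. B x y)" by (intro integral_nonneg par_i c nonneg)
    show "m (-a) = 0" "m a = 0" using zero[of _ a] zero[of _ "-a"] a by (auto simp: m_def)
  qed (use a m0 in \<open>auto simp: d_def intro!: par c\<close>)
  then have 1: "integral {-a..a} (\<lambda>y. (m y) ^ 3) \<le> 4 / 9 * (J s)\<^sup>2 * J B"
    by (simp add: J_def m_def[abs_def])
  have 2: "(J (\<lambda>x y. (s x y)\<^sup>2))\<^sup>2 \<le> integral {-a..a} (\<lambda>y. m y ^ 3 / 3) * J A"
    unfolding J_def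
  proof (rule integral_Cauchy_Schwarz_pointwise)
    fix y
    show "(integral {-a..a} (\<lambda>x. (s x y)\<^sup>2))\<^sup>2 \<le> m y ^ 3 / 3 * integral {-a..a} (\<lambda>x. A x y)"
      unfolding m_def
      using zero[of a y] zero[of "-a" y] a
      by (intro quartic_slice[OF _ sx slice(1)[OF c(2)] slice(1)[OF c(4)]] nonneg lex) auto
    show "0 \<le> m y ^ 3 / 3" using m0 by simp
    show "0 \<le> integral {-a..a} (\<lambda>x. A x y)" by (intro integral_nonneg par_i c nonneg)
    show "(\<lambda>y. m y ^ 3 / 3) integrable_on {- a..a}"
      unfolding m_def by (intro integrable_continuous_real continuous_intros par c) simp
  qed (intro par_i c c2)+
  have JA: "0 \<le> J A" unfolding J_def by (intro integral_nonneg par_i c nonneg)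
  have "integral {-a..a} (\<lambda>y. m y ^ 3 / 3) = integral {-a..a} (\<lambda>y. m y ^ 3) / 3" by simp
  then have "integral {-a..a} (\<lambda>y. m y ^ 3 / 3) * J A \<le> (4 / 9 * (J s)\<^sup>2 * J B) / 3 * J A"
    using 1 JA by (intro mult_right_mono) auto
  with 2 show ?thesis by (simp add: mult_ac)
qed

text \<open>Divergence theorem for a field (F, G) vanishing outside a square: the x-derivative
  integrates to zero on horizontal lines, the y-derivative on vertical lines once the order of
  integration is exchanged.\<close>

lemma planar_divergence_eq_0:
  fixes F G f g :: "real \<Rightarrow> real \<Rightarrow> real"
  assumes a: "0 \<le> a"
    and F: "\<And>x y. ((\<lambda>x. F x y) has_real_derivative f x y) (at x)"
    and G: "\<And>x y. ((\<lambda>y. G x y) has_real_derivative g x y) (at y)"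
    and c: "continuous_on UNIV (\<lambda>p. f (fst p) (snd p))" "continuous_on UNIV (\<lambda>p. g (fst p) (snd p))"
    and zero: "\<And>x y. \<bar>x\<bar> \<ge> a \<or> \<bar>y\<bar> \<ge> a \<Longrightarrow> F x y = 0 \<and> G x y = 0"
  shows "integral {-a..a} (\<lambda>y. integral {-a..a} (\<lambda>x. f x y + g x y)) = 0"
proof -
  have cf: "continuous_on S (\<lambda>z. f (g z) (h z))"
    if "continuous_on UNIV (\<lambda>p. f (fst p) (snd p))" "continuous_on S g" "continuous_on S h"
    for f :: "real \<Rightarrow> real \<Rightarrow> real" and g h :: "'z::topological_space \<Rightarrow> real" and S
    using continuous_on_compose2[OF that(1) continuous_on_Pair[OF that(2,3)]] by simp
  have i: "(\<lambda>x. f x y) integrable_on {-a..a}"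
    if "continuous_on UNIV (\<lambda>p. f (fst p) (snd p))" for f :: "real \<Rightarrow> real \<Rightarrow> real" and y
    by (intro integrable_continuous_real cf[OF that] continuous_intros)
  have 1: "integral {-a..a} (\<lambda>x. f x y) = 0" for y
    using zero a by (intro integral_unique integral_derivative_eq_0[OF _ F]) auto
  have 2: "integral {-a..a} (\<lambda>y. g x y) = 0" for x
    using zero a by (intro integral_unique integral_derivative_eq_0[OF _ G]) auto
  have "integral {-a..a} (\<lambda>y. integral {-a..a} (\<lambda>x. f x y + g x y)) =
      integral (cbox (-a) a) (\<lambda>y. integral (cbox (-a) a) (\<lambda>x. g x y))"
    using 1 i c by (simp add: integral_add)
  also have "\<dots> = integral (cbox (-a) a) (\<lambda>x. integral (cbox (-a) a) (\<lambda>y. g x y))"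
    by (rule integral_swap_continuous)
      (auto simp: case_prod_unfold intro!: cf[OF c(2)] continuous_intros)
  also have "\<dots> = 0" using 2 by simp
  finally show ?thesis .
qed

section \<open>Coordinates and Lebesgue measure on \<open>real^2\<close>\<close>

definition plane_vec :: "real \<Rightarrow> real \<Rightarrow> real^2" where
  "plane_vec x y = x *\<^sub>R axis 1 1 + y *\<^sub>R axis 2 1"

lemma plane_vec_nth [simp]: "plane_vec x y $ 1 = x" "plane_vec x y $ 2 = y"
  by (auto simp: plane_vec_def axis_def)

lemma norm_plane_vec_sq: "(norm (plane_vec x y))\<^sup>2 = x\<^sup>2 + y\<^sup>2"
  by (simp add: norm_vec_def L2_set_def sum_2)

lemma Basis_real2: "(Basis :: (real^2) set) = {axis 1 1, axis 2 1}"
  by (auto simp: Basis_vec_def UNIV_2)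

lemma axis_1_neq_2 [simp]: "(axis 1 1 :: real^2) \<noteq> axis 2 1"
  by (simp add: axis_eq_axis)

lemma continuous_plane_vec [continuous_intros]:
  "continuous_on S f \<Longrightarrow> continuous_on S g \<Longrightarrow> continuous_on S (\<lambda>z. plane_vec (f z) (g z))"
  unfolding plane_vec_def by (intro continuous_intros)

text \<open>Comparison on boxes. Pairs are read as (y, x), so that Fubini yields y as the outer and
  x as the inner variable, as in the slicing argument.\<close>

lemma lborel_real2_eq_distr:
  "lborel = distr (lborel :: (real \<times> real) measure) borel (\<lambda>p. plane_vec (snd p) (fst p))"
proof (rule lborel_eqI)
  have meas: "(\<lambda>p. plane_vec (snd p) (fst p)) \<in> borel_measurable (lborel :: (real \<times> real) measure)"
    by (simp, intro borel_measurable_continuous_onI continuous_intros)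
  fix l u :: "real^2" assume le: "\<And>b. b \<in> Basis \<Longrightarrow> l \<bullet> b \<le> u \<bullet> b"
  have le': "l $ 1 \<le> u $ 1" "l $ 2 \<le> u $ 2"
    using le[of "axis 1 1"] le[of "axis 2 1"] by (simp_all add: Basis_real2 inner_axis)
  have "(\<lambda>p. plane_vec (snd p) (fst p)) -` box l u = box (l $ 2, l $ 1) (u $ 2, u $ 1)"
    by (auto simp: box_def Basis_real2 inner_axis Basis_prod_def)
  moreover have "emeasure lborel (box (l $ 2, l $ 1) (u $ 2, u $ 1)) =
      ennreal (\<Prod>b\<in>Basis. ((u $ 2, u $ 1) - (l $ 2, l $ 1)) \<bullet> b)"
    using le' by (intro emeasure_lborel_box) (auto simp: Basis_prod_def)
  moreover have "(\<Prod>b\<in>Basis. ((u $ 2, u $ 1) - (l $ 2, l $ 1)) \<bullet> b) = (\<Prod>b\<in>Basis. (u - l) \<bullet> b)"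
    by (simp add: Basis_real2 inner_axis Basis_prod_def)
  ultimately show "emeasure (distr lborel borel (\<lambda>p. plane_vec (snd p) (fst p))) (box l u) =
      ennreal (\<Prod>b\<in>Basis. (u - l) \<bullet> b)"
    using meas by (simp add: emeasure_distr)
qed simp

text \<open>Links Lebesgue integrals over the plane with the iterated gauge integrals of the
  one-dimensional lemmas.\<close>

lemma integral_real2_square:
  fixes f :: "real^2 \<Rightarrow> real"
  assumes f: "continuous_on UNIV f"
    and zero: "\<And>x y. \<bar>x\<bar> > a \<or> \<bar>y\<bar> > a \<Longrightarrow> f (plane_vec x y) = 0"
  shows "integrable lborel f"
    and "integral\<^sup>L lborel f = integral {-a..a} (\<lambda>y. integral {-a..a} (\<lambda>x. f (plane_vec x y)))"
proof -
  define V where "V = (\<lambda>p. plane_vec (snd p) (fst p))"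
  define S where "S = cbox (-a, -a) (a, a)"
  have meas: "V \<in> borel_measurable (lborel :: (real \<times> real) measure)"
    unfolding V_def by (simp, intro borel_measurable_continuous_onI continuous_intros)
  have c: "continuous_on X (\<lambda>p. f (V p))" for X
    unfolding V_def by (rule continuous_on_compose2[OF f]) (auto intro!: continuous_intros)
  have eq: "indicator S p *\<^sub>R f (V p) = f (V p)" for p
  proof (cases "p \<in> S")
    case False
    then have "\<bar>snd p\<bar> > a \<or> \<bar>fst p\<bar> > a" by (cases p) (auto simp: S_def)
    then show ?thesis using zero False by (simp add: V_def)
  qed simp
  have int: "integrable lborel (\<lambda>p. f (V p))"
    using borel_integrable_compact[of S "\<lambda>p. f (V p)"] c unfolding eq by (simp add: S_def compact_cbox)
  have fm: "f \<in> borel_measurable borel" using f by (rule borel_measurable_continuous_onI)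
  show "integrable lborel f"
    unfolding lborel_real2_eq_distr V_def[symmetric] using int meas fm
    by (subst integrable_distr_eq) auto
  have "integral\<^sup>L lborel f = integral\<^sup>L lborel (\<lambda>p. f (V p))"
    unfolding lborel_real2_eq_distr V_def[symmetric] using meas fm
    by (subst integral_distr) auto
  also have "\<dots> = (LINT p:S|lborel. f (V p))"
    unfolding set_lebesgue_integral_def eq ..
  also have "\<dots> = integral S (\<lambda>p. f (V p))"
    using int by (intro set_borel_integral_eq_integral(2)) (unfold set_integrable_def eq)
  also have "\<dots> = integral (cbox (-a) a) (\<lambda>y. integral (cbox (-a) a) (\<lambda>x. f (V (y, x))))"
    unfolding S_def by (rule integral_prod_continuous) (rule c)
  finally show "integral\<^sup>L lborel f = integral {-a..a} (\<lambda>y. integral {-a..a} (\<lambda>x. f (plane_vec x y)))"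
    by (simp add: V_def)
qed

subsection \<open>The Bessel function\<close>

definition bessel_coeff :: "nat \<Rightarrow> real" where
  "bessel_coeff k = (-1) ^ k / (fact k)\<^sup>2"

text \<open>\<open>J\<^sub>0(x) = besselH (x\<^sup>2/4)\<close>; in the variable \<open>t = x\<^sup>2/4\<close> Bessel's equation
  becomes \<open>(t h')' = - h\<close>.\<close>

definition besselH :: "real \<Rightarrow> real" where
  "besselH t = (\<Sum>k. bessel_coeff k * t ^ k)"

definition besselH' :: "real \<Rightarrow> real" where
  "besselH' t = (\<Sum>k. diffs bessel_coeff k * t ^ k)"

lemma besselJ0_eq: "besselJ0 x = besselH (x\<^sup>2 / 4)"
proof -
  have "(x / 2) ^ (2 * k) = (x\<^sup>2 / 4) ^ k" for k
    unfolding power_mult by (simp add: power_divide)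
  then show ?thesis by (simp add: besselJ0_def besselH_def bessel_coeff_def)
qed

lemma summable_bessel: "summable (\<lambda>k. bessel_coeff k * t ^ k)"
proof (rule summable_comparison_test_ev[OF _ summable_exp[of "\<bar>t\<bar>"]])
  show "\<forall>\<^sub>F k in sequentially. norm (bessel_coeff k * t ^ k) \<le> inverse (fact k) * \<bar>t\<bar> ^ k"
  proof (rule always_eventually, rule allI)
    fix k
    have "1 / (fact k)\<^sup>2 \<le> (1 / fact k :: real)"
      by (simp add: divide_simps power2_eq_square)
    then show "norm (bessel_coeff k * t ^ k) \<le> inverse (fact k) * \<bar>t\<bar> ^ k"
      by (simp add: bessel_coeff_def abs_mult power_abs inverse_eq_divide mult_right_mono
          flip: times_divide_eq_left)
  qed
qed

lemma DERIV_besselH: "(besselH has_real_derivative besselH' t) (at t)"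
  unfolding besselH_def[abs_def] besselH'_def
  by (rule termdiffs_strong_converges_everywhere) (rule summable_bessel)

lemma summable_bessel': "summable (\<lambda>k. diffs bessel_coeff k * t ^ k)"
  by (rule termdiff_converges_all) (rule summable_bessel)

lemma isCont_besselH': "isCont besselH' t"
  unfolding besselH'_def[abs_def]
  by (rule DERIV_isCont, rule termdiffs_strong_converges_everywhere) (rule summable_bessel')

text \<open>Bessel's equation read off from the coefficients c_k: t h' has coefficients k c_k, and
  (k + 1)^2 c_(k+1) = - c_k.\<close>

lemma DERIV_t_besselH': "((\<lambda>t. t * besselH' t) has_real_derivative - besselH t) (at t)"
proof -
  define e where "e k = real k * bessel_coeff k" for k
  have e: "diffs bessel_coeff k = e (Suc k)" for k by (simp add: e_def diffs_def)
  have sum_e: "summable (\<lambda>k. e k * t ^ k)" for t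
    using summable_bessel'[of t] unfolding e by (simp add: summable_powser_split_head)
  have eq: "t * besselH' t = (\<Sum>k. e k * t ^ k)" for t
    using powser_split_head(2)[OF sum_e[of t]] by (simp add: besselH'_def e e_def mult.commute)
  have d: "diffs e k = - bessel_coeff k" for k
    by (simp add: diffs_def e_def bessel_coeff_def divide_simps power2_eq_square)
  have "((\<lambda>t. \<Sum>k. e k * t ^ k) has_real_derivative (\<Sum>k. diffs e k * t ^ k)) (at t)"
    by (rule termdiffs_strong_converges_everywhere) (rule sum_e)
  then show ?thesis
    unfolding eq d besselH_def using suminf_minus[OF summable_bessel[of t]] by simp
qed

lemma besselH_0: "besselH 0 = 1"
  unfolding besselH_def powser_zero by (simp add: bessel_coeff_def)

text \<open>The point t = 2 is x = sqrt 8, beyond the first zero of J_0; the sign is used to show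
  that J_0 has a positive zero at all. The first five terms add up to -7/36, and the remainder is an
  alternating tail.\<close>

lemma besselH_2_neg: "besselH 2 < 0"
proof -
  define b where "b k = 2 ^ k / (fact k :: real)\<^sup>2" for k :: nat
  have b: "bessel_coeff k * 2 ^ k = (-1) ^ k * b k" for k by (simp add: bessel_coeff_def b_def)
  have step: "b (Suc k) = b k * (2 / (real k + 1)\<^sup>2)" for k
    unfolding b_def fact_Suc power_mult_distrib power_Suc by (simp add: add.commute mult.commute)
  \<comment> \<open>From index 1 on the ratio 2/(k + 1)^2 is at most 1/2, whereas \<open>b 0\<close>
    = 1 and \<open>b 1\<close> = 2.\<close>
  have dec: "b (Suc k) \<le> b k" if "k \<ge> 1" for k
  proof -
    have "2\<^sup>2 \<le> (real k + 1)\<^sup>2" using that by (intro power_mono) auto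
    then have "2 / (real k + 1)\<^sup>2 \<le> 1" by (simp add: divide_simps)
    then show ?thesis unfolding step by (intro mult_left_le) (auto simp: b_def)
  qed
  have s: "summable (\<lambda>k. (-1) ^ k * b k)" using summable_bessel[of 2] unfolding b .
  have "besselH 2 = (\<Sum>k. (-1) ^ (k + 5) * b (k + 5)) + (\<Sum>k<5. (-1) ^ k * b k)"
    unfolding besselH_def b by (rule suminf_split_initial_segment[OF s])
  also have "(\<Sum>k. (-1) ^ (k + 5) * b (k + 5)) \<le> 0"
  proof -
    have s': "(\<lambda>k. (-1) ^ (k + 5) * b (k + 5)) sums (\<Sum>k. (-1) ^ (k + 5) * b (k + 5))"
      by (rule summable_sums[OF summable_ignore_initial_segment[OF s]])
    \<comment> \<open>The tail starts at the odd index 5, so each pair is a negative term followed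
      by a positive one that is no larger.\<close>
    have "(\<lambda>n. \<Sum>k\<in>{n * 2..<n * 2 + 2}. (-1) ^ (k + 5) * b (k + 5)) sums (\<Sum>k. (-1) ^ (k + 5) * b (k + 5))"
      by (rule sums_group[OF s']) simp
    then show ?thesis
    proof (rule sums_le[OF _ _ sums_zero, rotated])
      fix n show "(\<Sum>k\<in>{n * 2..<n * 2 + 2}. (-1) ^ (k + 5) * b (k + 5)) \<le> 0"
      proof -
        have "{n * 2..<n * 2 + 2} = {n * 2, n * 2 + 1}" by auto
        then show ?thesis
          using dec[of "n * 2 + 5"] by (simp add: minus_one_power_iff add.commute)
      qed
    qed
  qed
  also have "(\<Sum>k<5. (-1) ^ k * b k) < 0"
    by (simp add: b_def eval_nat_numeral)
  finally show ?thesis by simp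
qed

lemma continuous_on_besselH [continuous_intros]:
  "continuous_on S g \<Longrightarrow> continuous_on S (\<lambda>x. besselH (g x))"
  by (rule continuous_on_compose2[of UNIV])
    (auto intro!: continuous_at_imp_continuous_on DERIV_isCont[OF DERIV_besselH])

lemma continuous_on_besselH' [continuous_intros]:
  "continuous_on S g \<Longrightarrow> continuous_on S (\<lambda>x. besselH' (g x))"
  by (rule continuous_on_compose2[of UNIV])
    (auto intro!: continuous_at_imp_continuous_on isCont_besselH')

text \<open>The vector field \<open>X(v) = riccati c |v|\<^sup>2 *\<^sub>R v\<close> is the logarithmic gradient of
  \<open>J\<^sub>0(\<mu>\<rho>)\<close>, \<open>\<rho>\<^sup>2 = |v|\<^sup>2 - 1\<close>, pulled back along the area preserving map that sends the
  annulus to the punctured disc of the same area; \<open>riccati_supersolution\<close> says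
  \<open>- div X - |X|\<^sup>2 \<ge> 4 c\<close>.\<close>

definition riccati :: "real \<Rightarrow> real \<Rightarrow> real" where
  "riccati c t = 2 * (c * (t - 1) * besselH' (c * (t - 1))) / besselH (c * (t - 1)) / t"

definition riccati' :: "real \<Rightarrow> real \<Rightarrow> real" where
  "riccati' c t = 2 * c * (- 1 - c * (t - 1) * (besselH' (c * (t - 1)) / besselH (c * (t - 1)))\<^sup>2) / t
     - riccati c t / t"

lemma DERIV_riccati:
  assumes h: "besselH (c * (t - 1)) \<noteq> 0" and t: "t \<noteq> 0"
  shows "(riccati c has_real_derivative riccati' c t) (at t)"
proof -
  let ?r = "c * (t - 1)"
  \<comment> \<open>Keeping r h'(r) as one factor lets Bessel's equation supply its derivative; no
    second derivative of h appears.\<close>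
  have 1: "((\<lambda>t. c * (t - 1) * besselH' (c * (t - 1))) has_real_derivative - besselH ?r * c) (at t)"
    by (rule DERIV_chain2[OF DERIV_t_besselH']) (auto intro!: derivative_eq_intros)
  have 2: "((\<lambda>t. besselH (c * (t - 1))) has_real_derivative besselH' ?r * c) (at t)"
    by (rule DERIV_chain2[OF DERIV_besselH]) (auto intro!: derivative_eq_intros)
  have "((\<lambda>t. 2 * (c * (t - 1) * besselH' (c * (t - 1))) / besselH (c * (t - 1)) / t) has_real_derivative
     ((2 * (- besselH ?r * c) * besselH ?r - 2 * (?r * besselH' ?r) * (besselH' ?r * c))
        / (besselH ?r * besselH ?r) * t
      - 2 * (?r * besselH' ?r) / besselH ?r * 1) / (t * t)) (at t)"
    by (intro DERIV_divide DERIV_cmult DERIV_ident 1 2 h t)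
  moreover have "((2 * (- besselH ?r * c) * besselH ?r - 2 * (?r * besselH' ?r) * (besselH' ?r * c))
        / (besselH ?r * besselH ?r) * t
      - 2 * (?r * besselH' ?r) / besselH ?r * 1) / (t * t) = riccati' c t"
  proof -
    have "(2 * (- b * c) * b - 2 * (r * b') * (b' * c)) / (b * b) * t / (t * t)
       = 2 * c * (- 1 - r * (b' / b)\<^sup>2) / t" if "b \<noteq> 0" for b b' r
      using that t by (simp add: field_simps power2_eq_square)
    from this[OF h] show ?thesis
      by (simp add: riccati'_def riccati_def diff_divide_distrib)
  qed
  ultimately show ?thesis unfolding riccati_def[abs_def] by simp
qed

lemma riccati_supersolution:
  assumes c: "0 \<le> c" and t: "1 \<le> t"
  shows "4 * c \<le> - (2 * riccati c t + 2 * t * riccati' c t) - t * (riccati c t)\<^sup>2"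
proof -
  define q where "q = besselH' (c * (t - 1)) / besselH (c * (t - 1))"
  have r: "riccati c t = 2 * (c * (t - 1)) * q / t" by (simp add: riccati_def q_def)
  have "riccati' c t = (2 * c * (- 1 - c * (t - 1) * q\<^sup>2) - riccati c t) / t"
    by (simp add: riccati'_def q_def diff_divide_distrib)
  then have "t * riccati' c t = 2 * c * (- 1 - c * (t - 1) * q\<^sup>2) - riccati c t"
    using t by simp
  then have 1: "- (2 * riccati c t + 2 * t * riccati' c t) = 4 * c + 4 * c\<^sup>2 * (t - 1) * q\<^sup>2"
    by (simp add: algebra_simps power2_eq_square)
  \<comment> \<open>The only loss is (t - 1)/t = rho^2/r^2 <= 1, the factor by which passing to the
    disc shrinks the squared radial derivative.\<close>
  have "t * (riccati c t)\<^sup>2 = 4 * c\<^sup>2 * (t - 1) * q\<^sup>2 * ((t - 1) / t)"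
    using t by (simp add: r power2_eq_square)
  also have "\<dots> \<le> 4 * c\<^sup>2 * (t - 1) * q\<^sup>2 * 1" using t by (intro mult_left_mono) auto
  finally show ?thesis using 1 by simp
qed

text \<open>Positive zeros x of J_0 correspond to zeros t = x^2/4 of \<open>besselH\<close>. They
  exist by the intermediate value theorem on [0, 2], and continuity together with h(0) = 1 keeps
  them away from 0, so the infimum is positive. A zero t below mu0^2/4 would contradict the
  infimum.\<close>

lemma mu0_pos: "0 < mu0"
  and besselH_nonzero: "\<lbrakk>0 \<le> t; t < mu0\<^sup>2 / 4\<rbrakk> \<Longrightarrow> besselH t \<noteq> 0"
proof -
  define Z where "Z = {x. 0 < x \<and> besselJ0 x = 0}"
  have bdd: "bdd_below Z" unfolding Z_def by (intro bdd_belowI[of _ 0]) auto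
  have cont: "isCont besselH t" for t using DERIV_besselH by (rule DERIV_isCont)
  obtain z where z: "0 \<le> z" "besselH z = 0"
    using IVT2[of besselH 2 0 0] besselH_2_neg besselH_0 cont by auto
  then have "z > 0" using besselH_0 by (cases "z = 0") auto
  then have "2 * sqrt z \<in> Z" using z by (simp add: Z_def besselJ0_eq power_mult_distrib)
  then have ne: "Z \<noteq> {}" by auto
  have "\<forall>\<^sub>F t in at 0. besselH t > 0"
    using cont[of 0] besselH_0 unfolding isCont_def by (intro order_tendstoD(1)) auto
  then obtain r where r: "r > 0" "\<And>t. t \<noteq> 0 \<Longrightarrow> \<bar>t\<bar> < r \<Longrightarrow> besselH t > 0"
    unfolding eventually_at by (auto simp: dist_norm)
  have "2 * sqrt r \<le> Inf Z"
  proof (rule cInf_greatest[OF ne])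
    fix x assume "x \<in> Z"
    then have x: "x > 0" "besselH (x\<^sup>2 / 4) = 0" by (auto simp: Z_def besselJ0_eq)
    then have "x\<^sup>2 / 4 \<ge> r" using r(2)[of "x\<^sup>2 / 4"] by force
    then have "sqrt r \<le> sqrt (x\<^sup>2 / 4)" by simp
    then show "2 * sqrt r \<le> x" using x by (simp add: real_sqrt_divide)
  qed
  moreover have mu: "mu0 = Inf Z" by (simp add: mu0_def Z_def)
  ultimately show pos: "0 < mu0" using r(1) by (smt (verit) real_sqrt_gt_zero)
  show "besselH t \<noteq> 0" if t: "0 \<le> t" "t < mu0\<^sup>2 / 4"
  proof
    assume 0: "besselH t = 0"
    then have "t > 0" using besselH_0 t by (cases "t = 0") auto
    then have "2 * sqrt t \<in> Z" using 0 by (simp add: Z_def besselJ0_eq power_mult_distrib)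
    then have "mu0 \<le> 2 * sqrt t" unfolding mu using bdd by (rule cInf_lower)
    then have "mu0\<^sup>2 \<le> (2 * sqrt t)\<^sup>2" using pos by (intro power_mono) auto
    then show False using t by (simp add: power_mult_distrib)
  qed
qed

subsection \<open>Inequalities for test functions\<close>

lemma open_Omega: "open (Omega R)"
  unfolding Omega_def by (intro open_Collect_conj open_Collect_less continuous_intros)

lemma norm_sq_Omega:
  assumes "1 < R" "x \<in> Omega R"
  shows "1 < (norm x)\<^sup>2" "(norm x)\<^sup>2 < R\<^sup>2"
  using assms by (auto simp: Omega_def intro!: power_strict_mono one_less_power)

locale test_function =
  fixes R :: real and \<phi> :: "real^2 \<Rightarrow> 'b::euclidean_space" and D :: "real^2 \<Rightarrow> real^2 \<Rightarrow> 'b"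
  assumes R: "1 < R"
    and deriv: "\<And>x. (\<phi> has_derivative D x) (at x)"
    and cont: "\<And>i. i \<in> Basis \<Longrightarrow> continuous_on UNIV (\<lambda>x. D x i)"
    and support: "closure {x. \<phi> x \<noteq> 0} \<subseteq> Omega R"
begin

definition K where "K = closure {x. \<phi> x \<noteq> 0}"

lemma phi_off_K: "x \<notin> K \<Longrightarrow> \<phi> x = 0"
  unfolding K_def using closure_subset[of "{x. \<phi> x \<noteq> 0}"] by auto

lemma open_off_K: "open (- K)" by (simp add: K_def open_Compl)

lemma D_off_K: "x \<notin> K \<Longrightarrow> D x = (\<lambda>_. 0)"
proof -
  assume x: "x \<notin> K"
  have "(\<phi> has_derivative (\<lambda>_. 0)) (at x)"
    by (rule has_derivative_transform_within_open[OF has_derivative_const open_off_K, of x 0])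
      (use x phi_off_K in auto)
  then show ?thesis using deriv has_derivative_unique by blast
qed

lemma phi_cont: "continuous_on S \<phi>"
  using deriv has_derivative_continuous continuous_at_imp_continuous_on by blast

lemma D_cont: "continuous_on S (\<lambda>x. D x (axis 1 1))" "continuous_on S (\<lambda>x. D x (axis 2 1))"
  using cont[of "axis 1 1"] cont[of "axis 2 1"]
  by (auto simp: Basis_real2 intro: continuous_on_subset)

lemma K_bounds: "x \<in> K \<Longrightarrow> 1 < norm x \<and> norm x < R"
  using support by (auto simp: K_def Omega_def)

lemma K_nth: "x \<in> K \<Longrightarrow> \<bar>x $ i\<bar> < R"
  using K_bounds[of x] component_le_norm_cart[of x i] by auto

lemma off_square: "\<bar>x\<bar> \<ge> R \<or> \<bar>y\<bar> \<ge> R \<Longrightarrow> plane_vec x y \<notin> K"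
  using K_nth[of "plane_vec x y" 1] K_nth[of "plane_vec x y" 2] by auto

lemma has_deriv_line:
  "((\<lambda>t. \<phi> (v + t *\<^sub>R e)) has_vector_derivative D (v + t *\<^sub>R e) e) (at t)"
proof -
  have "((\<lambda>t. \<phi> (v + t *\<^sub>R e)) has_derivative (\<lambda>h. D (v + t *\<^sub>R e) (h *\<^sub>R e))) (at t)"
    by (rule has_derivative_compose[OF _ deriv]) (auto intro!: derivative_eq_intros)
  moreover have "linear (D (v + t *\<^sub>R e))"
    using deriv has_derivative_linear by blast
  ultimately show ?thesis
    by (simp add: has_vector_derivative_def linear_scale)
qed

lemma norm_sq_deriv:
  "((\<lambda>x. (norm (\<phi> (plane_vec x y)))\<^sup>2) has_real_derivative
     2 * (\<phi> (plane_vec x y) \<bullet> D (plane_vec x y) (axis 1 1))) (at x)"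
  "((\<lambda>y. (norm (\<phi> (plane_vec x y)))\<^sup>2) has_real_derivative
     2 * (\<phi> (plane_vec x y) \<bullet> D (plane_vec x y) (axis 2 1))) (at y)"
proof -
  have *: "((\<lambda>t. (norm (\<phi> (v + t *\<^sub>R e)))\<^sup>2) has_real_derivative
     2 * (\<phi> (v + t *\<^sub>R e) \<bullet> D (v + t *\<^sub>R e) e)) (at t)" for v e t
  proof -
    have "((\<lambda>t. \<phi> (v + t *\<^sub>R e) \<bullet> \<phi> (v + t *\<^sub>R e)) has_derivative
      (\<lambda>h. \<phi> (v + t *\<^sub>R e) \<bullet> (h *\<^sub>R D (v + t *\<^sub>R e) e) + (h *\<^sub>R D (v + t *\<^sub>R e) e) \<bullet> \<phi> (v + t *\<^sub>R e))) (at t)"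
      using has_deriv_line[of v e t] unfolding has_vector_derivative_def
      by (intro has_derivative_inner)
    then show ?thesis
      unfolding has_field_derivative_def power2_norm_eq_inner
      by (rule has_derivative_eq_rhs) (auto simp: inner_commute algebra_simps)
  qed
  show "((\<lambda>x. (norm (\<phi> (plane_vec x y)))\<^sup>2) has_real_derivative
     2 * (\<phi> (plane_vec x y) \<bullet> D (plane_vec x y) (axis 1 1))) (at x)"
    using *[of "y *\<^sub>R axis 2 1" "axis 1 1" x] by (simp add: plane_vec_def add.commute)
  show "((\<lambda>y. (norm (\<phi> (plane_vec x y)))\<^sup>2) has_real_derivative
     2 * (\<phi> (plane_vec x y) \<bullet> D (plane_vec x y) (axis 2 1))) (at y)"
    using *[of "x *\<^sub>R axis 1 1" "axis 2 1" y] by (simp add: plane_vec_def)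
qed

lemma integral_square:
  fixes f :: "real^2 \<Rightarrow> real"
  assumes "continuous_on UNIV f" "\<And>x. x \<notin> K \<Longrightarrow> f x = 0"
  shows "integrable lborel f"
    and "integral\<^sup>L lborel f = integral {-R..R} (\<lambda>y. integral {-R..R} (\<lambda>x. f (plane_vec x y)))"
  using integral_real2_square[of f R] assms off_square by force+

definition "mass = (LINT x|lborel. (norm (\<phi> x))\<^sup>2)"
definition "energy e = (LINT x|lborel. (norm (D x e))\<^sup>2)"

lemma energy_nonneg: "0 \<le> energy e"
  unfolding energy_def by (intro integral_nonneg_AE) auto

lemma mass_nonneg: "0 \<le> mass"
  unfolding mass_def by (intro integral_nonneg_AE) auto

lemma integrable_energy:
  "e \<in> Basis \<Longrightarrow> integrable lborel (\<lambda>x. (norm (D x e))\<^sup>2)"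
  by (intro integral_square continuous_intros cont) (auto simp: D_off_K)

lemma integrable_mass: "integrable lborel (\<lambda>x. (norm (\<phi> x))\<^sup>2)"
  by (intro integral_square continuous_intros phi_cont) (auto simp: phi_off_K)

lemma integrable_quartic: "integrable lborel (\<lambda>x. (norm (\<phi> x)) ^ 4)"
  by (intro integral_square continuous_intros phi_cont) (auto simp: phi_off_K)

lemma Gagliardo_Nirenberg:
  "(LINT x|lborel. (norm (\<phi> x)) ^ 4)\<^sup>2 \<le> 4 / 27 * mass\<^sup>2 * (energy (axis 1 1) * energy (axis 2 1))"
proof -
  define J where "J f = integral {-R..R} (\<lambda>y. integral {-R..R} (\<lambda>x. f x y))"
    for f :: "real \<Rightarrow> real \<Rightarrow> real"
  define V where "V = plane_vec"
  have c: "continuous_on UNIV (\<lambda>p. f (V (fst p) (snd p)))" if "continuous_on UNIV f"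
    for f :: "real^2 \<Rightarrow> real"
    unfolding V_def by (rule continuous_on_compose2[OF that]) (auto intro!: continuous_intros)
  \<comment> \<open>Cauchy-Schwarz in the value space supplies \<open>lex\<close> and
    \<open>ley\<close> for |phi|^2, whatever the dimension of the values.\<close>
  have CS: "(2 * (p \<bullet> q))\<^sup>2 \<le> 4 * (norm p)\<^sup>2 * (norm q)\<^sup>2" for p q :: 'b
    using Cauchy_Schwarz_ineq[of p q] by (simp add: power_mult_distrib power2_norm_eq_inner)
  have "(J (\<lambda>x y. ((norm (\<phi> (V x y)))\<^sup>2)\<^sup>2))\<^sup>2 \<le> 4 / 27 * (J (\<lambda>x y. (norm (\<phi> (V x y)))\<^sup>2))\<^sup>2
     * (J (\<lambda>x y. (norm (D (V x y) (axis 1 1)))\<^sup>2) * J (\<lambda>x y. (norm (D (V x y) (axis 2 1)))\<^sup>2))"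
    unfolding J_def
    by (rule planar_Gagliardo_Nirenberg[where
          sx="\<lambda>x y. 2 * (\<phi> (V x y) \<bullet> D (V x y) (axis 1 1))" and
          sy="\<lambda>x y. 2 * (\<phi> (V x y) \<bullet> D (V x y) (axis 2 1))"])
      (use R norm_sq_deriv CS off_square phi_off_K in
        \<open>auto simp: V_def[symmetric] intro!: continuous_intros c phi_cont D_cont\<close>)
  moreover have "mass = J (\<lambda>x y. (norm (\<phi> (V x y)))\<^sup>2)"
    unfolding mass_def J_def V_def
    by (intro integral_square continuous_intros phi_cont) (auto simp: phi_off_K)
  moreover have "energy e = J (\<lambda>x y. (norm (D (V x y) e))\<^sup>2)" if "e \<in> Basis" for e
    unfolding energy_def J_def V_def using that
    by (intro integral_square continuous_intros cont) (auto simp: D_off_K)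
  moreover have "(LINT x|lborel. (norm (\<phi> x)) ^ 4) = J (\<lambda>x y. ((norm (\<phi> (V x y)))\<^sup>2)\<^sup>2)"
    unfolding J_def V_def
    by (subst integral_square) (auto simp: phi_off_K intro!: continuous_intros phi_cont)
  ultimately show ?thesis by (simp add: Basis_real2)
qed

text \<open>For the field X(v) = f(|v|^2) v, expand the nonnegative sum of |D_i phi - X_i phi|^2.
  Its cross term is -div(|phi|^2 X) + |phi|^2 div X; the divergence integrates to zero, and -div X -
  |X|^2 >= 4 c bounds the rest.\<close>

lemma Faber_Krahn_annulus:
  "mu0\<^sup>2 / (R\<^sup>2 - 1) * mass \<le> energy (axis 1 1) + energy (axis 2 1)"
proof -
  \<comment> \<open>Chosen so that c (R^2 - 1) = mu0^2/4: the argument of \<open>besselH\<close>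
    reaches the first zero only on the outer circle.\<close>
  define c where "c = mu0\<^sup>2 / 4 / (R\<^sup>2 - 1)"
  have R2: "R\<^sup>2 > 1" using R by (simp add: one_less_power)
  have c0: "c > 0" using R2 mu0_pos by (simp add: c_def)
  define f g where "f = riccati c" and "g = riccati' c"
  \<comment> \<open>\<open>F i\<close> is the i-th component of |phi|^2 X and \<open>E i\<close> its
    i-th partial derivative, so \<open>E 1 + E 2\<close> is the divergence.\<close>
  define F where "F i v = (norm (\<phi> v))\<^sup>2 * (f ((norm v)\<^sup>2) * v $ i)" for i :: 2 and v
  define E where "E i v = 2 * (\<phi> v \<bullet> D v (axis i 1)) * (f ((norm v)\<^sup>2) * v $ i)
     + (norm (\<phi> v))\<^sup>2 * (f ((norm v)\<^sup>2) + 2 * (v $ i)\<^sup>2 * g ((norm v)\<^sup>2))" for i :: 2 and v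
  note range = norm_sq_Omega[OF R]
  have h: "besselH (c * ((norm v)\<^sup>2 - 1)) \<noteq> 0" if "v \<in> Omega R" for v
  proof (rule besselH_nonzero)
    show "0 \<le> c * ((norm v)\<^sup>2 - 1)" using range[OF that] c0 by simp
    have "c * ((norm v)\<^sup>2 - 1) < c * (R\<^sup>2 - 1)" using range[OF that] c0 by simp
    also have "\<dots> = mu0\<^sup>2 / 4" unfolding c_def using R2 by (intro nonzero_eq_divide_eq[THEN iffD1]) auto
    finally show "c * ((norm v)\<^sup>2 - 1) < mu0\<^sup>2 / 4" .
  qed
  have n0: "norm v \<noteq> 0" if "v \<in> Omega R" for v using that by (auto simp: Omega_def)
  have fc: "continuous_on (Omega R) (\<lambda>v. f ((norm v)\<^sup>2))"
    unfolding f_def riccati_def using h n0 by (intro continuous_intros) auto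
  have gc: "continuous_on (Omega R) (\<lambda>v. g ((norm v)\<^sup>2))"
    unfolding g_def riccati'_def using h n0 by (intro continuous_intros fc[unfolded f_def]) auto
  have off: "F i v = 0" "E i v = 0" if "v \<notin> K" for i v
    using that phi_off_K by (auto simp: F_def E_def)
  \<comment> \<open>X may blow up at the outer circle, so continuity on the plane is glued from two
    open sets: the annulus, and the complement of the support, where everything is zero.\<close>
  have cover: "UNIV = Omega R \<union> - K" using support by (auto simp: K_def)
  have Ec: "continuous_on UNIV (E i)" for i
    unfolding cover
  proof (rule continuous_on_open_Un[OF open_Omega open_off_K])
    have "continuous_on (Omega R) (\<lambda>x. D x (axis i 1))"
      using cont[of "axis i 1"] by (auto simp: axis_in_Basis_iff intro: continuous_on_subset)
    then show "continuous_on (Omega R) (E i)"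
      unfolding E_def[abs_def] by (intro continuous_intros phi_cont fc gc)
    show "continuous_on (- K) (E i)"
      by (rule continuous_on_eq[of _ "\<lambda>_. 0"]) (auto simp: off)
  qed
  have fd: "(f has_real_derivative g t) (at t)" if "t = (norm v)\<^sup>2" "v \<in> Omega R" for t v
    unfolding f_def g_def using h[OF that(2)] n0[OF that(2)] that(1) by (intro DERIV_riccati) auto
  have d1: "((\<lambda>x. F 1 (plane_vec x y)) has_real_derivative E 1 (plane_vec x y)) (at x)" for x y
  proof (cases "plane_vec x y \<in> K")
    case True
    then have O: "plane_vec x y \<in> Omega R" using support by (auto simp: K_def)
    have "((\<lambda>x. f ((norm (plane_vec x y))\<^sup>2)) has_real_derivative g ((norm (plane_vec x y))\<^sup>2) * (2 * x)) (at x)"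
      by (rule DERIV_chain2[where f=f and g="\<lambda>x. (norm (plane_vec x y))\<^sup>2", OF fd[OF refl O]], unfold norm_plane_vec_sq)
        (auto intro!: derivative_eq_intros)
    from DERIV_mult[OF norm_sq_deriv(1) DERIV_mult[OF this DERIV_ident]]
    show ?thesis unfolding F_def E_def
      by (simp add: power2_eq_square algebra_simps)
  next
    case False
    have "open ((\<lambda>x. plane_vec x y) -` (- K))"
      by (rule open_vimage[OF open_off_K]) (intro continuous_intros)
    then have "((\<lambda>x. F 1 (plane_vec x y)) has_real_derivative 0) (at x)"
      using False by (intro has_field_derivative_transform_within_open[OF DERIV_const[of 0]])
        (auto simp: off)
    then show ?thesis using False by (simp add: off)
  qed
  have d2: "((\<lambda>y. F 2 (plane_vec x y)) has_real_derivative E 2 (plane_vec x y)) (at y)" for x y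
  proof (cases "plane_vec x y \<in> K")
    case True
    then have O: "plane_vec x y \<in> Omega R" using support by (auto simp: K_def)
    have "((\<lambda>y. f ((norm (plane_vec x y))\<^sup>2)) has_real_derivative g ((norm (plane_vec x y))\<^sup>2) * (2 * y)) (at y)"
      by (rule DERIV_chain2[where f=f and g="\<lambda>y. (norm (plane_vec x y))\<^sup>2", OF fd[OF refl O]], unfold norm_plane_vec_sq)
        (auto intro!: derivative_eq_intros)
    from DERIV_mult[OF norm_sq_deriv(2) DERIV_mult[OF this DERIV_ident]]
    show ?thesis unfolding F_def E_def
      by (simp add: power2_eq_square algebra_simps)
  next
    case False
    have "open ((\<lambda>y. plane_vec x y) -` (- K))"
      by (rule open_vimage[OF open_off_K]) (intro continuous_intros)
    then have "((\<lambda>y. F 2 (plane_vec x y)) has_real_derivative 0) (at y)"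
      using False by (intro has_field_derivative_transform_within_open[OF DERIV_const[of 0]])
        (auto simp: off)
    then show ?thesis using False by (simp add: off)
  qed
  have Vc: "continuous_on UNIV (\<lambda>p. E i (plane_vec (fst p) (snd p)))" for i
    by (rule continuous_on_compose2[OF Ec]) (auto intro!: continuous_intros)
  have Ei: "integrable lborel (\<lambda>v. E 1 v + E 2 v)"
    "(LINT v|lborel. E 1 v + E 2 v) = integral {-R..R} (\<lambda>y. integral {-R..R}
       (\<lambda>x. E 1 (plane_vec x y) + E 2 (plane_vec x y)))"
    by (intro integral_square continuous_intros Ec, simp add: off)+
  note Ei(2)
  also have "integral {-R..R} (\<lambda>y. integral {-R..R} (\<lambda>x. E 1 (plane_vec x y) + E 2 (plane_vec x y))) = 0"
    using R off_square off by (intro planar_divergence_eq_0[OF _ d1 d2 Vc Vc]) auto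
  finally have E0: "(LINT v|lborel. E 1 v + E 2 v) = 0" .
  have pw: "4 * c * (norm (\<phi> v))\<^sup>2 + (E 1 v + E 2 v)
      \<le> (norm (D v (axis 1 1)))\<^sup>2 + (norm (D v (axis 2 1)))\<^sup>2" for v
  proof (cases "v \<in> K")
    case True
    then have O: "v \<in> Omega R" using support by (auto simp: K_def)
    define t where "t = (norm v)\<^sup>2"
    have t: "t = (v $ 1)\<^sup>2 + (v $ 2)\<^sup>2"
      by (simp add: t_def norm_vec_def L2_set_def sum_2)
    define s where "s = \<phi> v \<bullet> \<phi> v"
    have s: "(norm (\<phi> v))\<^sup>2 = s" by (simp add: s_def power2_norm_eq_inner)
    define p where "p i = \<phi> v \<bullet> D v (axis i 1)" for i :: 2
    have sq: "(norm (D v (axis i 1) - (f t * v $ i) *\<^sub>R \<phi> v))\<^sup>2 =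
      (norm (D v (axis i 1)))\<^sup>2 - 2 * (f t * v $ i) * p i + (f t)\<^sup>2 * (v $ i)\<^sup>2 * s" for i :: 2
      unfolding power2_norm_eq_inner p_def s_def
      by (simp add: inner_diff_left inner_diff_right inner_commute algebra_simps power2_eq_square)
    have "0 \<le> (norm (D v (axis 1 1) - (f t * v $ 1) *\<^sub>R \<phi> v))\<^sup>2 + (norm (D v (axis 2 1) - (f t * v $ 2) *\<^sub>R \<phi> v))\<^sup>2"
      by simp
    also have "\<dots> = (norm (D v (axis 1 1)))\<^sup>2 + (norm (D v (axis 2 1)))\<^sup>2
       - 2 * f t * (v $ 1 * p 1 + v $ 2 * p 2) + (f t)\<^sup>2 * t * s"
      unfolding sq by (simp add: t algebra_simps)
    finally have 1: "2 * f t * (v $ 1 * p 1 + v $ 2 * p 2) - (f t)\<^sup>2 * t * s \<le>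
        (norm (D v (axis 1 1)))\<^sup>2 + (norm (D v (axis 2 1)))\<^sup>2" by simp
    have 2: "E 1 v + E 2 v = 2 * f t * (v $ 1 * p 1 + v $ 2 * p 2) + s * (2 * f t + 2 * t * g t)"
      unfolding E_def t_def[symmetric] s p_def[symmetric] by (simp add: t algebra_simps)
    have "4 * c \<le> - (2 * f t + 2 * t * g t) - t * (f t)\<^sup>2"
      unfolding f_def g_def using range[OF O] c0 by (intro riccati_supersolution) (auto simp: t_def)
    then have "s * (4 * c) \<le> s * (- (2 * f t + 2 * t * g t) - t * (f t)\<^sup>2)"
      by (intro mult_left_mono) (simp_all add: s_def)
    then have "4 * c * s + s * (2 * f t + 2 * t * g t) \<le> - (f t)\<^sup>2 * t * s"
      by (simp add: algebra_simps)
    then show ?thesis using 1 unfolding 2 s by simp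
  next
    case False then show ?thesis by (simp add: off phi_off_K)
  qed
  have e: "energy (axis 1 1) + energy (axis 2 1) =
      (LINT v|lborel. (norm (D v (axis 1 1)))\<^sup>2 + (norm (D v (axis 2 1)))\<^sup>2)"
    unfolding energy_def using integrable_energy
    by (intro Bochner_Integration.integral_add[symmetric]) (auto simp: Basis_real2)
  have "4 * c * mass = (LINT v|lborel. 4 * c * (norm (\<phi> v))\<^sup>2 + (E 1 v + E 2 v))"
    using integrable_mass Ei(1) E0 by (simp add: mass_def)
  also have "\<dots> \<le> energy (axis 1 1) + energy (axis 2 1)"
    unfolding e using integrable_mass Ei(1) integrable_energy pw
    by (intro integral_mono) (auto simp: Basis_real2)
  finally have "4 * c * mass \<le> energy (axis 1 1) + energy (axis 2 1)" .
  moreover have "4 * (a / 4 / b) = a / b" for a b :: real by simp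
  ultimately show ?thesis unfolding c_def by metis
qed

text \<open>The product of the two directional energies is at most N^2/4, which turns the planar
  inequality into a bound by mass * N / sqrt 27; the Faber-Krahn inequality then replaces the mass
  by energy.\<close>

lemma quartic_energy_bound:
  "(LINT x|lborel. (norm (\<phi> x)) ^ 4) \<le>
     2 / (3 * pi) * (R\<^sup>2 - 1) / mu0\<^sup>2 * (energy (axis 1 1) + energy (axis 2 1))\<^sup>2"
proof -
  define N where "N = energy (axis 1 1) + energy (axis 2 1)"
  have R2: "R\<^sup>2 > 1" using R by (simp add: one_less_power)
  have N0: "0 \<le> N" using energy_nonneg by (simp add: N_def)
  have M: "mass \<le> (R\<^sup>2 - 1) / mu0\<^sup>2 * N"
    using Faber_Krahn_annulus R2 mu0_pos by (simp add: N_def field_simps)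
  have "energy (axis 1 1) * energy (axis 2 1) \<le> N\<^sup>2 / 4"
    using sum_squares_ge_zero[of "energy (axis 1 1) - energy (axis 2 1)" 0]
    by (simp add: N_def power2_eq_square algebra_simps)
  then have "4 / 27 * mass\<^sup>2 * (energy (axis 1 1) * energy (axis 2 1)) \<le> 4 / 27 * mass\<^sup>2 * (N\<^sup>2 / 4)"
    by (intro mult_left_mono) auto
  then have "(LINT x|lborel. (norm (\<phi> x)) ^ 4)\<^sup>2 \<le> 1 / 27 * (mass * N)\<^sup>2"
    using Gagliardo_Nirenberg by (simp add: power_mult_distrib mult_ac)
  also have "\<dots> \<le> (2 / (3 * pi))\<^sup>2 * (mass * N)\<^sup>2"
  proof (rule mult_right_mono)
    \<comment> \<open>The comparison of 1/(3 sqrt 3) with 2/(3 pi), squared, amounts to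
      this.\<close>
    have "pi\<^sup>2 \<le> 12"
      using power_mono[of pi "3.3" 2] pi_less_4 pi_approx(2) by (simp add: power2_eq_square)
    then show "1 / 27 \<le> (2 / (3 * pi))\<^sup>2" by (simp add: power_divide power_mult_distrib field_simps)
  qed simp
  finally have "(LINT x|lborel. (norm (\<phi> x)) ^ 4)\<^sup>2 \<le> (2 / (3 * pi) * (mass * N))\<^sup>2"
    unfolding power_mult_distrib[of "2 / (3 * pi)"] .
  then have "(LINT x|lborel. (norm (\<phi> x)) ^ 4) \<le> 2 / (3 * pi) * (mass * N)"
    by (rule power2_le_imp_le) (use mass_nonneg N0 in auto)
  also have "\<dots> \<le> 2 / (3 * pi) * ((R\<^sup>2 - 1) / mu0\<^sup>2 * N * N)"
    using M N0 by (intro mult_left_mono mult_right_mono) auto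
  also have "\<dots> = 2 / (3 * pi) * (R\<^sup>2 - 1) / mu0\<^sup>2 * N\<^sup>2"
    by (simp add: power2_eq_square[of N])
  finally show ?thesis unfolding N_def .
qed

end

subsection \<open>Passage to the Sobolev space\<close>

lemma set_nn_integral_eq_LINT:
  fixes f :: "'a \<Rightarrow> real"
  assumes "set_integrable M A f" and "\<And>x. 0 \<le> f x"
  shows "(\<integral>\<^sup>+x\<in>A. ennreal (f x) \<partial>M) = ennreal (LINT x:A|M. f x)"
proof -
  have "(\<integral>\<^sup>+x\<in>A. ennreal (f x) \<partial>M) = (\<integral>\<^sup>+x. ennreal (indicator A x *\<^sub>R f x) \<partial>M)"
    by (intro nn_integral_cong) (auto simp: indicator_def)
  also have "\<dots> = ennreal (LINT x:A|M. f x)"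
    unfolding set_lebesgue_integral_def using assms
    by (intro nn_integral_eq_integral) (auto simp: set_integrable_def)
  finally show ?thesis .
qed

lemma set_integrable_if_nn_integral_finite:
  fixes f :: "'a \<Rightarrow> real"
  assumes [measurable]: "f \<in> borel_measurable M" "A \<in> sets M"
    and "\<And>x. 0 \<le> f x" and "(\<integral>\<^sup>+x\<in>A. ennreal (f x) \<partial>M) < \<infinity>"
  shows "set_integrable M A f"
  unfolding set_integrable_def
proof (rule integrableI_nonneg)
  have "(\<integral>\<^sup>+x. ennreal (indicator A x *\<^sub>R f x) \<partial>M) = (\<integral>\<^sup>+x\<in>A. ennreal (f x) \<partial>M)"
    by (intro nn_integral_cong) (auto simp: indicator_def)
  then show "(\<integral>\<^sup>+x. ennreal (indicator A x *\<^sub>R f x) \<partial>M) < \<infinity>" using assms by simp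
qed (use assms in \<open>auto\<close>)

text \<open>Young's inequality; after the triangle inequality the defect is the square (\<epsilon> p
  - q)^2 / \<epsilon>. A factor close to 1 on |b|^2 preserves the constant in the limit.\<close>

lemma norm_sq_le_weighted:
  fixes a b :: "'b::real_normed_vector"
  assumes "0 < \<epsilon>"
  shows "(norm a)\<^sup>2 \<le> (1 + \<epsilon>) * (norm b)\<^sup>2 + (1 + 1 / \<epsilon>) * (norm (a - b))\<^sup>2"
proof -
  define p q where "p = norm b" and "q = norm (a - b)"
  have "(norm a)\<^sup>2 \<le> (p + q)\<^sup>2"
    using norm_triangle_ineq[of b "a - b"] by (intro power_mono) (auto simp: p_def q_def)
  also have "\<dots> \<le> (1 + \<epsilon>) * p\<^sup>2 + (1 + 1 / \<epsilon>) * q\<^sup>2"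
  proof -
    have "(1 + \<epsilon>) * p\<^sup>2 + (1 + 1 / \<epsilon>) * q\<^sup>2 - (p + q)\<^sup>2 = (\<epsilon> * p - q)\<^sup>2 / \<epsilon>"
      using assms by (simp add: field_simps power2_eq_square)
    then show ?thesis using assms by (smt (verit) divide_nonneg_pos zero_le_power2)
  qed
  finally show ?thesis by (simp add: p_def q_def)
qed

text \<open>A one-sided comparison up to the factor 1 + \<epsilon> is all that an upper bound in the
  limit requires. Integrability of |g|^2 is a conclusion: a single \<open>f n\<close> at finite
  distance from \<open>g\<close> provides it.\<close>

lemma L2_limit_norm:
  fixes f :: "nat \<Rightarrow> 'a \<Rightarrow> 'b::euclidean_space"
  assumes [measurable]: "A \<in> sets M" "\<And>n. f n \<in> borel_measurable M" "g \<in> borel_measurable M"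
    and fi: "\<And>n. set_integrable M A (\<lambda>x. (norm (f n x))\<^sup>2)"
    and lim: "(\<lambda>n. \<integral>\<^sup>+x\<in>A. ennreal ((norm (f n x - g x))\<^sup>2) \<partial>M) \<longlonglongrightarrow> 0"
  shows "set_integrable M A (\<lambda>x. (norm (g x))\<^sup>2)"
    and "0 < \<epsilon> \<Longrightarrow> \<forall>\<^sub>F n in sequentially.
      (LINT x:A|M. (norm (f n x))\<^sup>2) \<le> (1 + \<epsilon>) * (LINT x:A|M. (norm (g x))\<^sup>2) + \<epsilon>"
proof -
  define \<delta> where "\<delta> n = (\<integral>\<^sup>+x\<in>A. ennreal ((norm (f n x - g x))\<^sup>2) \<partial>M)" for n
  have ev: "\<forall>\<^sub>F n in sequentially. \<delta> n < e" if "0 < e" for e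
    using order_tendstoD(2)[OF lim that] by (simp add: \<delta>_def)
  have di: "set_integrable M A (\<lambda>x. (norm (f n x - g x))\<^sup>2)" if "\<delta> n < \<infinity>" for n
    using that by (intro set_integrable_if_nn_integral_finite) (auto simp: \<delta>_def)
  \<comment> \<open>The distances live in the extended reals, and finitely many of them may be
    infinite.\<close>
  obtain n where "\<delta> n < 1"
    using ev[of 1] by (auto simp: eventually_sequentially)
  then have n: "\<delta> n < \<infinity>" by (rule order.strict_trans) simp
  have "set_integrable M A (\<lambda>x. 2 * (norm (f n x))\<^sup>2 + 2 * (norm (f n x - g x))\<^sup>2)"
    using di[OF n] fi by (intro set_integral_add) auto
  then show gi: "set_integrable M A (\<lambda>x. (norm (g x))\<^sup>2)"
  proof (rule set_integrable_bound)
    show "set_borel_measurable M A (\<lambda>x. (norm (g x))\<^sup>2)"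
      unfolding set_borel_measurable_def by measurable
    show "AE x in M. x \<in> A \<longrightarrow> norm ((norm (g x))\<^sup>2) \<le>
        norm (2 * (norm (f n x))\<^sup>2 + 2 * (norm (f n x - g x))\<^sup>2)"
    proof (intro AE_I2 impI)
      fix x
      show "norm ((norm (g x))\<^sup>2) \<le> norm (2 * (norm (f n x))\<^sup>2 + 2 * (norm (f n x - g x))\<^sup>2)"
        using norm_sq_le_weighted[of 1 "g x" "f n x"] by (simp add: norm_minus_commute)
    qed
  qed
  assume e: "0 < \<epsilon>"
  \<comment> \<open>Chosen so that (1 + 1/\<epsilon>) e' = \<epsilon>.\<close>
  define e' where "e' = \<epsilon> / (1 + 1 / \<epsilon>)"
  have e': "e' > 0" using e by (auto simp: e'_def intro!: divide_pos_pos add_pos_pos)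
  have "\<forall>\<^sub>F n in sequentially. \<delta> n < ennreal e'" using e' by (intro ev) simp
  then show "\<forall>\<^sub>F n in sequentially.
      (LINT x:A|M. (norm (f n x))\<^sup>2) \<le> (1 + \<epsilon>) * (LINT x:A|M. (norm (g x))\<^sup>2) + \<epsilon>"
  proof eventually_elim
    case (elim n)
    then have "\<delta> n < \<infinity>" using order.strict_trans by fastforce
    note d = di[OF this]
    have "\<delta> n = ennreal (LINT x:A|M. (norm (f n x - g x))\<^sup>2)"
      unfolding \<delta>_def using d by (intro set_nn_integral_eq_LINT) auto
    then have le: "(LINT x:A|M. (norm (f n x - g x))\<^sup>2) \<le> e'"
      using elim by (metis ennreal_leI leD linorder_le_cases)
    have "(LINT x:A|M. (norm (f n x))\<^sup>2) \<le>
        (LINT x:A|M. (1 + \<epsilon>) * (norm (g x))\<^sup>2 + (1 + 1 / \<epsilon>) * (norm (f n x - g x))\<^sup>2)"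
      using fi gi d norm_sq_le_weighted[OF e] by (intro set_integral_mono set_integral_add) auto
    also have "\<dots> = (1 + \<epsilon>) * (LINT x:A|M. (norm (g x))\<^sup>2) + (1 + 1 / \<epsilon>) * (LINT x:A|M. (norm (f n x - g x))\<^sup>2)"
      using gi d by (subst set_integral_add(2)) auto
    also have "(1 + 1 / \<epsilon>) * (LINT x:A|M. (norm (f n x - g x))\<^sup>2) \<le> (1 + 1 / \<epsilon>) * e'"
      using le e by (intro mult_left_mono) auto
    also have "(1 + 1 / \<epsilon>) * e' = \<epsilon>" using e by (simp add: e'_def add_pos_pos less_imp_neq[THEN not_sym])
    finally show ?case by simp
  qed
qed

text \<open>L^2 convergence is L^1 convergence of the squared distance, which has a subsequence
  converging almost everywhere.\<close>

lemma L2_limit_AE_subseq: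
  fixes f :: "nat \<Rightarrow> 'a \<Rightarrow> 'b::euclidean_space"
  assumes [measurable]: "A \<in> sets M" "\<And>n. f n \<in> borel_measurable M" "g \<in> borel_measurable M"
    and lim: "(\<lambda>n. \<integral>\<^sup>+x\<in>A. ennreal ((norm (f n x - g x))\<^sup>2) \<partial>M) \<longlonglongrightarrow> 0"
  obtains r :: "nat \<Rightarrow> nat" where "strict_mono r"
    "AE x in M. x \<in> A \<longrightarrow> (\<lambda>n. f (r n) x) \<longlonglongrightarrow> g x"
proof -
  define \<delta> where "\<delta> n = (\<integral>\<^sup>+x\<in>A. ennreal ((norm (f n x - g x))\<^sup>2) \<partial>M)" for n
  have lim': "\<delta> \<longlonglongrightarrow> 0" using lim by (simp add: \<delta>_def[abs_def])
  \<comment> \<open>Dropping the first \<open>N\<close> terms removes infinite distances and makes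
    every \<open>u n\<close> integrable.\<close>
  obtain N where N: "\<And>n. n \<ge> N \<Longrightarrow> \<delta> n < 1"
    using order_tendstoD(2)[OF lim', of 1] by (auto simp: eventually_sequentially)
  define u where "u n x = indicator A x *\<^sub>R (norm (f (n + N) x - g x))\<^sup>2" for n x
  have si: "set_integrable M A (\<lambda>x. (norm (f (n + N) x - g x))\<^sup>2)" for n
    using N[of "n + N"] order.strict_trans[of "\<delta> (n + N)" 1 \<infinity>]
    by (intro set_integrable_if_nn_integral_finite) (auto simp: \<delta>_def)
  have "\<exists>r::nat\<Rightarrow>nat. strict_mono r \<and> (AE x in M. (\<lambda>n. u (r n) x) \<longlonglongrightarrow> 0)"
  proof (rule tendsto_L1_AE_subseq)
    show "integrable M (u n)" for n using si[of n] by (simp add: u_def[abs_def] set_integrable_def)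
    have "(\<integral>x. norm (u n x) \<partial>M) = enn2real (\<delta> (n + N))" for n
    proof -
      have "(\<integral>x. norm (u n x) \<partial>M) = (LINT x:A|M. (norm (f (n + N) x - g x))\<^sup>2)"
        unfolding set_lebesgue_integral_def u_def by (intro Bochner_Integration.integral_cong) auto
      moreover have "\<delta> (n + N) = ennreal (LINT x:A|M. (norm (f (n + N) x - g x))\<^sup>2)"
        unfolding \<delta>_def using si by (intro set_nn_integral_eq_LINT) auto
      moreover have "0 \<le> (LINT x:A|M. (norm (f (n + N) x - g x))\<^sup>2)"
        unfolding set_lebesgue_integral_def by (intro integral_nonneg_AE) auto
      ultimately show ?thesis by simp
    qed
    moreover have "(\<lambda>n. enn2real (\<delta> (n + N))) \<longlonglongrightarrow> 0"
      using tendsto_enn2real[of "\<lambda>n. \<delta> (n + N)" 0 sequentially]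
        LIMSEQ_ignore_initial_segment[OF lim', of N] by simp
    ultimately show "(\<lambda>n. \<integral>x. norm (u n x) \<partial>M) \<longlonglongrightarrow> 0" by simp
  qed
  then obtain r :: "nat \<Rightarrow> nat" where r: "strict_mono r" "AE x in M. (\<lambda>n. u (r n) x) \<longlonglongrightarrow> 0" by auto
  show thesis
  proof (rule that)
    show "strict_mono (\<lambda>n. r n + N)" using r(1) by (simp add: strict_mono_def)
    show "AE x in M. x \<in> A \<longrightarrow> (\<lambda>n. f (r n + N) x) \<longlonglongrightarrow> g x"
      using r(2)
    proof eventually_elim
      case (elim x)
      show ?case
      proof
        assume "x \<in> A"
        then have "(\<lambda>n. (norm (f (r n + N) x - g x))\<^sup>2) \<longlonglongrightarrow> 0"
          using elim by (simp add: u_def)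
        then have "(\<lambda>n. sqrt ((norm (f (r n + N) x - g x))\<^sup>2)) \<longlonglongrightarrow> sqrt 0"
          by (rule tendsto_real_sqrt)
        then show "(\<lambda>n. f (r n + N) x) \<longlonglongrightarrow> g x"
          by (simp add: LIM_zero_iff tendsto_norm_zero_iff)
      qed
    qed
  qed
qed

lemma Omega_sets: "Omega R \<in> sets lborel"
  using open_Omega[of R] by simp

text \<open>Fatou's lemma along an almost everywhere convergent subsequence of the approximants.
  Membership in L^4 is not part of \<open>H10\<close>; it comes out together with the bound.\<close>

lemma H10_quartic_bound:
  fixes w :: "real^2 \<Rightarrow> 'b::euclidean_space"
  assumes R: "1 < R" and H: "H10 R w g"
  shows "set_integrable lebesgue (Omega R) (\<lambda>x. (norm (w x)) ^ 4)"
    and "(LINT x:Omega R|lebesgue. (norm (w x)) ^ 4) \<le>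
      2 / (3 * pi) * (R\<^sup>2 - 1) / mu0\<^sup>2 * (grad_sq R g)\<^sup>2"
proof -
  define C where "C = 2 / (3 * pi) * (R\<^sup>2 - 1) / mu0\<^sup>2"
  have C0: "C \<ge> 0" using R by (simp add: C_def one_le_power)
  have Os [measurable]: "Omega R \<in> sets lebesgue" using Omega_sets by simp
  from H obtain \<phi> D where wm [measurable]: "w \<in> borel_measurable lebesgue"
    and gm: "\<And>i. i \<in> Basis \<Longrightarrow> g i \<in> borel_measurable lebesgue"
    and deriv: "\<And>n x. (\<phi> n has_derivative D n x) (at x)"
    and Dc: "\<And>n i. i \<in> Basis \<Longrightarrow> continuous_on UNIV (\<lambda>x. D n x i)"
    and supp: "\<And>n. closure {x. \<phi> n x \<noteq> 0} \<subseteq> Omega R"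
    and limw: "(\<lambda>n. \<integral>\<^sup>+ x \<in> Omega R. ennreal ((norm (\<phi> n x - w x))\<^sup>2) \<partial>lebesgue) \<longlonglongrightarrow> 0"
    and limg: "\<And>i. i \<in> Basis \<Longrightarrow>
      (\<lambda>n. \<integral>\<^sup>+ x \<in> Omega R. ennreal ((norm (D n x i - g i x))\<^sup>2) \<partial>lebesgue) \<longlonglongrightarrow> 0"
    unfolding H10_def by blast
  interpret t: test_function R "\<phi> n" "D n" for n
    by unfold_locales (use R deriv Dc supp in auto)
  have phm [measurable]: "\<phi> n \<in> borel_measurable lebesgue" for n
    using borel_measurable_continuous_onI[OF t.phi_cont] by (intro measurable_completion) simp
  have Dm: "(\<lambda>x. D n x i) \<in> borel_measurable lebesgue" if "i \<in> Basis" for n i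
    using borel_measurable_continuous_onI[OF Dc[OF that]] by (intro measurable_completion) simp
  have off: "x \<notin> Omega R \<Longrightarrow> \<phi> n x = 0" "x \<notin> Omega R \<Longrightarrow> D n x i = 0" for n x i
  proof -
    assume "x \<notin> Omega R"
    then have "x \<notin> t.K n" using supp[of n] unfolding t.K_def by blast
    then show "\<phi> n x = 0" "D n x i = 0" using t.phi_off_K t.D_off_K by metis+
  qed
  have axis_in_Basis_one: "axis i 1 \<in> (Basis :: (real^2) set)" for i
    by (auto simp: Basis_vec_def)
  have Di: "set_integrable lebesgue (Omega R) (\<lambda>x. (norm (D n x i))\<^sup>2)"
    and Dl: "(LINT x:Omega R|lebesgue. (norm (D n x i))\<^sup>2) = t.energy n i" if "i \<in> Basis" for n i
  proof -
    have eq: "indicator (Omega R) x *\<^sub>R (norm (D n x i))\<^sup>2 = (norm (D n x i))\<^sup>2" for x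
      using off(2)[of x n i] by (auto simp: indicator_def)
    show "set_integrable lebesgue (Omega R) (\<lambda>x. (norm (D n x i))\<^sup>2)"
      unfolding set_integrable_def eq using t.integrable_energy[OF that]
      by (simp add: integrable_completion borel_measurable_integrable)
    show "(LINT x:Omega R|lebesgue. (norm (D n x i))\<^sup>2) = t.energy n i"
      unfolding set_lebesgue_integral_def eq t.energy_def using t.integrable_energy[OF that]
      by (intro integral_completion borel_measurable_integrable)
  qed
  define N where "N = grad_sq R g"
  have N: "N = (LINT x:Omega R|lebesgue. (norm (g (axis 1 1) x))\<^sup>2)
      + (LINT x:Omega R|lebesgue. (norm (g (axis 2 1) x))\<^sup>2)"
    by (simp add: N_def grad_sq_def Basis_real2)
  have ev: "\<forall>\<^sub>F n in sequentially. t.energy n i \<le>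
      (1 + \<epsilon>) * (LINT x:Omega R|lebesgue. (norm (g i x))\<^sup>2) + \<epsilon>" if "i \<in> Basis" "0 < \<epsilon>" for i \<epsilon>
    using L2_limit_norm(2)[OF Os Dm gm Di limg, OF that(1) that(1) that(1) that(1) that(2)]
    by (simp add: Dl that)
  obtain r :: "nat \<Rightarrow> nat" where r: "strict_mono r"
    and conv: "AE x in lebesgue. x \<in> Omega R \<longrightarrow> (\<lambda>n. \<phi> (r n) x) \<longlonglongrightarrow> w x"
    using L2_limit_AE_subseq[OF Os phm wm limw] by blast
  have q: "(\<integral>\<^sup>+x\<in>Omega R. ennreal ((norm (\<phi> n x)) ^ 4) \<partial>lebesgue) =
      ennreal (LINT x|lborel. (norm (\<phi> n x)) ^ 4)" for n
  proof -
    have "(\<integral>\<^sup>+x\<in>Omega R. ennreal ((norm (\<phi> n x)) ^ 4) \<partial>lebesgue) =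
        (\<integral>\<^sup>+x. ennreal ((norm (\<phi> n x)) ^ 4) \<partial>lborel)"
      using off(1) by (subst nn_integral_completion[symmetric]) (auto intro!: nn_integral_cong simp: indicator_def)
    also have "\<dots> = ennreal (LINT x|lborel. (norm (\<phi> n x)) ^ 4)"
      by (intro nn_integral_eq_integral t.integrable_quartic) auto
    finally show ?thesis .
  qed
  \<comment> \<open>A nonnegative integral is used because integrability of |w|^4 is still unknown.
    The term 2 \<epsilon> collects one \<epsilon> from each of the two partial derivatives.\<close>
  have main: "(\<integral>\<^sup>+x\<in>Omega R. ennreal ((norm (w x)) ^ 4) \<partial>lebesgue) \<le>
      ennreal (C * ((1 + \<epsilon>) * N + 2 * \<epsilon>)\<^sup>2)" if e: "0 < \<epsilon>" for \<epsilon>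
  proof -
    have "(\<integral>\<^sup>+x\<in>Omega R. ennreal ((norm (w x)) ^ 4) \<partial>lebesgue) =
        (\<integral>\<^sup>+x. liminf (\<lambda>n. ennreal ((norm (\<phi> (r n) x)) ^ 4) * indicator (Omega R) x) \<partial>lebesgue)"
    proof (rule nn_integral_cong_AE, use conv in eventually_elim)
      case (elim x)
      have "(\<lambda>n. ennreal ((norm (\<phi> (r n) x)) ^ 4) * indicator (Omega R) x) \<longlonglongrightarrow>
          ennreal ((norm (w x)) ^ 4) * indicator (Omega R) x"
        using elim by (cases "x \<in> Omega R") (auto intro!: tendsto_ennrealI tendsto_intros)
      then show ?case by (rule lim_imp_Liminf[rotated, symmetric]) simp
    qed
    also have "\<dots> \<le> liminf (\<lambda>n. \<integral>\<^sup>+x\<in>Omega R. ennreal ((norm (\<phi> (r n) x)) ^ 4) \<partial>lebesgue)"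
      by (rule nn_integral_liminf) measurable
    also have "\<dots> \<le> limsup (\<lambda>n. \<integral>\<^sup>+x\<in>Omega R. ennreal ((norm (\<phi> (r n) x)) ^ 4) \<partial>lebesgue)"
      by (rule Liminf_le_Limsup) simp
    also have "\<dots> \<le> ennreal (C * ((1 + \<epsilon>) * N + 2 * \<epsilon>)\<^sup>2)"
    proof (rule Limsup_bounded)
      have "\<forall>\<^sub>F n in sequentially. ennreal (LINT x|lborel. (norm (\<phi> n x)) ^ 4) \<le>
          ennreal (C * ((1 + \<epsilon>) * N + 2 * \<epsilon>)\<^sup>2)"
        using ev[of "axis 1 1", OF axis_in_Basis_one e] ev[of "axis 2 1", OF axis_in_Basis_one e]
      proof eventually_elim
        case (elim n)
        have "(LINT x|lborel. (norm (\<phi> n x)) ^ 4) \<le> C * (t.energy n (axis 1 1) + t.energy n (axis 2 1))\<^sup>2"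
          unfolding C_def by (rule t.quartic_energy_bound)
        also have "\<dots> \<le> C * ((1 + \<epsilon>) * N + 2 * \<epsilon>)\<^sup>2"
          using elim t.energy_nonneg[of n] C0
          by (intro mult_left_mono power_mono add_nonneg_nonneg) (auto simp: N algebra_simps)
        finally show ?case by (rule ennreal_leI)
      qed
      then show "\<forall>\<^sub>F n in sequentially.
          (\<integral>\<^sup>+x\<in>Omega R. ennreal ((norm (\<phi> (r n) x)) ^ 4) \<partial>lebesgue) \<le>
          ennreal (C * ((1 + \<epsilon>) * N + 2 * \<epsilon>)\<^sup>2)"
        unfolding q by (rule eventually_subseq[OF r])
    qed
    finally show ?thesis .
  qed
  \<comment> \<open>Any fixed \<epsilon> makes the integral finite; 1 is as good as any.\<close>
  have wi: "set_integrable lebesgue (Omega R) (\<lambda>x. (norm (w x)) ^ 4)"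
    using main[of 1] by (intro set_integrable_if_nn_integral_finite)
      (auto simp: less_top[symmetric] top_unique)
  then show "set_integrable lebesgue (Omega R) (\<lambda>x. (norm (w x)) ^ 4)" .
  have "(LINT x:Omega R|lebesgue. (norm (w x)) ^ 4) \<le> C * ((1 + \<epsilon>) * N + 2 * \<epsilon>)\<^sup>2" if "0 < \<epsilon>" for \<epsilon>
    using main[OF that] C0 set_nn_integral_eq_LINT[OF wi] by simp
  \<comment> \<open>Letting \<epsilon> tend to 0 recovers the constant \<open>C\<close>.\<close>
  then have "\<forall>\<^sub>F \<epsilon> in at_right 0. (LINT x:Omega R|lebesgue. (norm (w x)) ^ 4) \<le> C * ((1 + \<epsilon>) * N + 2 * \<epsilon>)\<^sup>2"
    by (auto simp: eventually_at_right_less eventually_at_filter)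
  moreover have "((\<lambda>\<epsilon>. C * ((1 + \<epsilon>) * N + 2 * \<epsilon>)\<^sup>2) \<longlongrightarrow> C * ((1 + 0) * N + 2 * 0)\<^sup>2) (at_right 0)"
    by (intro tendsto_intros)
  ultimately have "(LINT x:Omega R|lebesgue. (norm (w x)) ^ 4) \<le> C * ((1 + 0) * N + 2 * 0)\<^sup>2"
    by (intro tendsto_lowerbound) auto
  then show "(LINT x:Omega R|lebesgue. (norm (w x)) ^ 4) \<le>
      2 / (3 * pi) * (R\<^sup>2 - 1) / mu0\<^sup>2 * (grad_sq R g)\<^sup>2"
    by (simp add: C_def N_def)
qed

lemma H10_L4_bound:
  fixes w :: "real^2 \<Rightarrow> 'b::euclidean_space"
  assumes R: "1 < R" and H: "H10 R w g"
  shows "L4_sq R w \<le> (1 / mu0) * sqrt (2 / (3 * pi) * (R\<^sup>2 - 1)) * grad_sq R g"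
proof -
  have g: "0 \<le> grad_sq R g"
    unfolding grad_sq_def set_lebesgue_integral_def
    by (intro sum_nonneg integral_nonneg_AE) auto
  have "L4_sq R w \<le> sqrt (2 / (3 * pi) * (R\<^sup>2 - 1) / mu0\<^sup>2 * (grad_sq R g)\<^sup>2)"
    unfolding L4_sq_def using H10_quartic_bound(2)[OF R H] by (rule real_sqrt_le_mono)
  also have "\<dots> = sqrt (2 / (3 * pi) * (R\<^sup>2 - 1)) / mu0 * grad_sq R g"
    using g mu0_pos by (simp only: real_sqrt_mult real_sqrt_divide real_sqrt_abs abs_of_nonneg abs_of_pos)
  finally show ?thesis by simp
qed

subsection \<open>The torsion function\<close>

text \<open>Polar coordinates for radial functions: the area element is pi d(r^2), hence pi times
  Lebesgue measure in t = |x|^2. The measures are compared on rays.\<close>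

lemma distr_norm_sq_Omega:
  assumes R: "1 < R"
  shows "distr (density lborel (indicator (Omega R))) borel (\<lambda>x. (norm x)\<^sup>2) =
    density lborel (\<lambda>t. ennreal pi * indicator {1<..<R\<^sup>2} t)" (is "?M = ?N")
proof (rule measure_eqI_lessThan)
  note [measurable] = Omega_sets[simplified]
  have R2: "1 < R\<^sup>2" using R by (simp add: one_less_power)
  have M: "emeasure ?M {a<..} = ennreal (pi * (R\<^sup>2 - max 1 (min a (R\<^sup>2))))" for a
  proof -
    \<comment> \<open>Clamping \<open>a\<close> to [1, R^2] merges all positions of the ray into one
      annulus sqrt b < |x| < R.\<close>
    define b where "b = max 1 (min a (R\<^sup>2))"
    have b: "1 \<le> b" "b \<le> R\<^sup>2" using R2 by (auto simp: b_def)
    have sb: "sqrt b \<le> R" using b R by (simp add: real_le_lsqrt)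
    have iff: "x \<in> Omega R \<and> a < (norm x)\<^sup>2 \<longleftrightarrow> norm x < R \<and> sqrt b < norm x" for x
    proof -
      have "norm x < R \<longleftrightarrow> (norm x)\<^sup>2 < R\<^sup>2" using R by (auto intro: power_strict_mono power2_less_imp_less)
      moreover have "1 < norm x \<longleftrightarrow> 1 < (norm x)\<^sup>2"
        using power2_less_imp_less[of 1 "norm x"] by (auto intro: one_less_power)
      moreover have "sqrt b < norm x \<longleftrightarrow> b < (norm x)\<^sup>2"
        using real_less_rsqrt[of "sqrt b" "(norm x)\<^sup>2"] real_sqrt_less_iff[of b "(norm x)\<^sup>2"] by simp
      ultimately show ?thesis by (auto simp: Omega_def b_def)
    qed
    have "emeasure ?M {a<..} = emeasure (density lborel (indicator (Omega R))) {x. a < (norm x)\<^sup>2}"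
      by (subst emeasure_distr) (auto simp: vimage_def)
    also have "\<dots> = (\<integral>\<^sup>+x. indicator (Omega R) x * indicator {x. a < (norm x)\<^sup>2} x \<partial>lborel)"
      by (subst emeasure_density) auto
    also have "\<dots> = (\<integral>\<^sup>+x. indicator {x \<in> Omega R. a < (norm x)\<^sup>2} x \<partial>lborel)"
      by (intro nn_integral_cong) (auto simp: indicator_def)
    also have "\<dots> = emeasure lborel {x \<in> Omega R. a < (norm x)\<^sup>2}"
      by (rule nn_integral_indicator) measurable
    also have "{x \<in> Omega R. a < (norm x)\<^sup>2} = ball 0 R - cball 0 (sqrt b)"
      unfolding set_eq_iff mem_Collect_eq Diff_iff iff by (simp add: not_le)
    also have "emeasure lborel (ball 0 R - cball 0 (sqrt b) :: (real^2) set) =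
        emeasure lborel (ball 0 R - ball 0 (sqrt b) :: (real^2) set)"
    proof (rule emeasure_eq_AE)
      have "AE x in lborel. x \<notin> sphere (0 :: real^2) (sqrt b)"
        by (intro AE_not_in) (simp add: negligible_iff_null_sets[symmetric] null_sets_completion_iff[symmetric] negligible_sphere)
      then show "AE x in lborel. (x \<in> ball 0 R - cball (0 :: real^2) (sqrt b)) = (x \<in> ball 0 R - ball 0 (sqrt b))"
        by eventually_elim auto
    qed auto
    also have "\<dots> = emeasure lborel (ball 0 R :: (real^2) set) - emeasure lborel (ball 0 (sqrt b) :: (real^2) set)"
      using sb b by (intro emeasure_Diff) (auto simp: emeasure_ball)
    also have "\<dots> = ennreal (pi * R\<^sup>2) - ennreal (pi * b)"
      using R b by (simp add: emeasure_ball unit_ball_vol_2)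
    also have "\<dots> = ennreal (pi * (R\<^sup>2 - b))"
      using b by (subst ennreal_minus) (auto simp: algebra_simps)
    finally show ?thesis by (simp add: b_def)
  qed
  show "emeasure ?M {a<..} < \<infinity>" for a unfolding M by simp
  show "emeasure ?M {a<..} = emeasure ?N {a<..}" for a
  proof -
    have "emeasure ?N {a<..} = (\<integral>\<^sup>+t. ennreal pi * indicator {max 1 (min a (R\<^sup>2))<..<R\<^sup>2} t \<partial>lborel)"
      by (subst emeasure_density) (auto intro!: nn_integral_cong simp: indicator_def)
    also have "\<dots> = ennreal pi * ennreal (R\<^sup>2 - max 1 (min a (R\<^sup>2)))"
      using R2 by (subst nn_integral_cmult_indicator) auto
    also have "\<dots> = ennreal (pi * (R\<^sup>2 - max 1 (min a (R\<^sup>2))))"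
      using R2 by (simp add: ennreal_mult)
    finally show ?thesis using M by simp
  qed
qed simp_all

lemma radial_integral:
  fixes F :: "real \<Rightarrow> real"
  assumes R: "1 < R" and F [measurable]: "F \<in> borel_measurable borel" and c: "continuous_on {1..R\<^sup>2} F"
  shows "set_integrable lebesgue (Omega R) (\<lambda>x. F ((norm x)\<^sup>2))"
    and "(LINT x:Omega R|lebesgue. F ((norm x)\<^sup>2)) = pi * integral {1..R\<^sup>2} F"
proof -
  note [measurable] = Omega_sets[simplified]
  \<comment> \<open>\<open>F\<close> is controlled only on [1, R^2]. Cut off, it is integrable on
    the line and still agrees with \<open>F\<close> at |x|^2 for x in the annulus.\<close>
  define G where "G t = indicator {1<..<R\<^sup>2} t * F t" for t
  have Gm [measurable]: "G \<in> borel_measurable borel" unfolding G_def[abs_def] by measurable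
  have "set_integrable lborel {1..R\<^sup>2} F"
    unfolding set_integrable_def using c by (intro borel_integrable_compact) auto
  then have Gi: "integrable lborel G" and GF: "(LINT t|lborel. G t) = integral {1..R\<^sup>2} F"
  proof -
    assume i: "set_integrable lborel {1..R\<^sup>2} F"
    have s: "set_integrable lborel {1<..<R\<^sup>2} F" by (rule set_integrable_subset[OF i]) auto
    then show "integrable lborel G" by (simp add: set_integrable_def G_def[abs_def])
    have "(LINT t|lborel. G t) = (LINT t:{1<..<R\<^sup>2}|lborel. F t)"
      by (simp add: set_lebesgue_integral_def G_def)
    also have "\<dots> = integral {1<..<R\<^sup>2} F" using s by (rule set_borel_integral_eq_integral)
    also have "\<dots> = integral {1..R\<^sup>2} F" by (rule integral_open_interval_real[symmetric])
    finally show "(LINT t|lborel. G t) = integral {1..R\<^sup>2} F" .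
  qed
  have eq: "indicator (Omega R) x *\<^sub>R F ((norm x)\<^sup>2) = indicator (Omega R) x *\<^sub>R G ((norm x)\<^sup>2)" for x
  proof (cases "x \<in> Omega R")
    case True
    then show ?thesis using norm_sq_Omega[OF R] by (simp add: G_def)
  qed simp
  have pp: "(\<lambda>t. ennreal pi * indicator {1<..<R\<^sup>2} t) = (\<lambda>t. ennreal (pi * indicator {1<..<R\<^sup>2} t))"
    by (auto simp: indicator_def)
  have Gp: "(pi * indicator {1<..<R\<^sup>2} t) *\<^sub>R G t = pi * G t" for t
    by (simp add: G_def indicator_def)
  have ii: "(\<lambda>x. indicator (Omega R) x :: ennreal) = (\<lambda>x. ennreal (indicator (Omega R) x))"
    by (auto simp: indicator_def)
  have "integrable (density lborel (\<lambda>t. ennreal pi * indicator {1<..<R\<^sup>2} t)) G"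
    unfolding pp
  proof (subst integrable_density)
    show "integrable lborel (\<lambda>t. (pi * indicator {1<..<R\<^sup>2} t) *\<^sub>R G t)" unfolding Gp using Gi by simp
  qed auto
  then have 1: "integrable (density lborel (indicator (Omega R))) (\<lambda>x. G ((norm x)\<^sup>2))"
    unfolding distr_norm_sq_Omega[OF R, symmetric] by (subst (asm) integrable_distr_eq) auto
  then have 2: "integrable lborel (\<lambda>x. indicator (Omega R) x *\<^sub>R G ((norm x)\<^sup>2))"
    unfolding ii by (subst (asm) integrable_density) auto
  then show "set_integrable lebesgue (Omega R) (\<lambda>x. F ((norm x)\<^sup>2))"
    unfolding set_integrable_def eq by (simp add: integrable_completion)
  have "(LINT x:Omega R|lebesgue. F ((norm x)\<^sup>2)) = (LINT x|lborel. indicator (Omega R) x *\<^sub>R G ((norm x)\<^sup>2))"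
    unfolding set_lebesgue_integral_def eq by (rule integral_completion) measurable
  also have "\<dots> = (LINT x|density lborel (indicator (Omega R)). G ((norm x)\<^sup>2))"
    unfolding ii by (subst integral_density) auto
  also have "\<dots> = (LINT t|distr (density lborel (indicator (Omega R))) borel (\<lambda>x. (norm x)\<^sup>2). G t)"
    by (subst integral_distr) auto
  also have "\<dots> = (LINT t|lborel. (pi * indicator {1<..<R\<^sup>2} t) *\<^sub>R G t)"
    unfolding distr_norm_sq_Omega[OF R] pp by (subst integral_density) auto
  also have "\<dots> = pi * integral {1..R\<^sup>2} F" unfolding Gp using GF by simp
  finally show "(LINT x:Omega R|lebesgue. F ((norm x)\<^sup>2)) = pi * integral {1..R\<^sup>2} F" .
qed

section \<open>The torsion function: sign, energy and fourth power\<close>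

text \<open>Written in t = |x|^2. As a function of x it vanishes on both boundary circles and its
  Laplacian is the constant -4 ln R.\<close>

definition torsion :: "real \<Rightarrow> real \<Rightarrow> real" where
  "torsion R t = (R\<^sup>2 - 1) / 2 * ln t - (t - 1) * ln R"

definition torsion' :: "real \<Rightarrow> real \<Rightarrow> real" where
  "torsion' R t = (R\<^sup>2 - 1) / 2 / t - ln R"

lemma DERIV_torsion: "0 < t \<Longrightarrow> (torsion R has_real_derivative torsion' R t) (at t)"
  unfolding torsion_def[abs_def] torsion'_def
  by (auto intro!: derivative_eq_intros simp: field_simps)

lemma torsion_ends: "1 < R \<Longrightarrow> torsion R 1 = 0" "1 < R \<Longrightarrow> torsion R (R\<^sup>2) = 0"
  by (auto simp: torsion_def ln_realpow)

text \<open>Strict concavity: \<open>torsion'\<close> is strictly decreasing, and with zero values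
  at both ends the mean value theorem on either side of \<open>t\<close> rules out a nonpositive
  value.\<close>

lemma torsion_pos:
  assumes R: "1 < R" and t: "1 < t" "t < R\<^sup>2"
  shows "0 < torsion R t"
proof (rule ccontr)
  assume "\<not> 0 < torsion R t"
  then have neg: "torsion R t \<le> 0" by simp
  obtain x where x: "1 < x" "x < t" "torsion R t - torsion R 1 = (t - 1) * torsion' R x"
    using MVT2[of 1 t "torsion R" "torsion' R"] t DERIV_torsion by auto
  obtain y where y: "t < y" "y < R\<^sup>2" "torsion R (R\<^sup>2) - torsion R t = (R\<^sup>2 - t) * torsion' R y"
    using MVT2[of t "R\<^sup>2" "torsion R" "torsion' R"] t DERIV_torsion by auto
  have "torsion' R x \<le> 0"
    using x neg t by (simp add: torsion_ends R mult_le_0_iff)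
  moreover have "0 \<le> torsion' R y"
    using y neg t by (simp add: torsion_ends R)
      (smt (verit) mult_pos_neg)
  moreover have "torsion' R y < torsion' R x"
    unfolding torsion'_def using x y R by (intro diff_strict_right_mono divide_strict_left_mono) (auto simp: one_less_power)
  ultimately show False by simp
qed

text \<open>The integrand is the squared gradient at |x|^2 = t, since the gradient is 2
  torsion'(|x|^2) x.\<close>

lemma torsion_energy:
  assumes R: "1 < R"
  shows "integral {1..R\<^sup>2} (\<lambda>t. 4 * (torsion' R t)\<^sup>2 * t) =
    2 * (((R\<^sup>2 + 1) * ln R + 1 - R\<^sup>2) * (R\<^sup>2 - 1) * ln R)"
proof (rule integral_unique)
  define L P where "L = ln R" and "P = R\<^sup>2"
  have P: "1 < P" using R by (simp add: P_def one_less_power)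
  have lP: "ln P = 2 * L" using R by (simp add: P_def L_def ln_realpow)
  \<comment> \<open>Termwise antiderivative of the expanded square (P - 1)^2/t - 4 (P - 1) L + 4 L^2
    t.\<close>
  define G where "G t = (P - 1)\<^sup>2 * ln t - 4 * (P - 1) * L * t + 2 * L\<^sup>2 * t\<^sup>2" for t
  have "((\<lambda>t. 4 * (torsion' R t)\<^sup>2 * t) has_integral (G P - G 1)) {1..P}"
  proof (rule fundamental_theorem_of_calculus)
    fix t assume "t \<in> {1..P}"
    then have t: "t > 0" by simp
    have "(G has_real_derivative (P - 1)\<^sup>2 / t - 4 * (P - 1) * L + 4 * L\<^sup>2 * t) (at t within {1..P})"
      unfolding G_def[abs_def] using t by (auto intro!: derivative_eq_intros)
    moreover have "(P - 1)\<^sup>2 / t - 4 * (P - 1) * L + 4 * L\<^sup>2 * t = 4 * ((P - 1) / 2 / t - L)\<^sup>2 * t"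
      using t by (simp add: field_simps power2_eq_square)
    ultimately show "(G has_vector_derivative 4 * (torsion' R t)\<^sup>2 * t) (at t within {1..P})"
      by (simp add: torsion'_def P_def L_def has_real_derivative_iff_has_vector_derivative)
  qed (use P in simp)
  moreover have "G P - G 1 = 2 * (((P + 1) * L + 1 - P) * (P - 1) * L)"
    by (simp add: G_def lP) (simp add: algebra_simps power2_eq_square)
  ultimately show "((\<lambda>t. 4 * (torsion' R t)\<^sup>2 * t) has_integral
      2 * (((R\<^sup>2 + 1) * ln R + 1 - R\<^sup>2) * (R\<^sup>2 - 1) * ln R)) {1..R\<^sup>2}"
    by (simp add: P_def L_def)
qed

text \<open>With \<open>s = \<alpha> ln t + L\<close>, so that \<open>ds = \<alpha> dt / t\<close>, this is an antiderivative in \<open>t\<close> of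
  \<open>(s - L t)\<^sup>4\<close>: expand in powers of \<open>t\<close> and integrate each \<open>t\<^sup>j s\<^sup>m\<close> by parts.\<close>

definition quartic_primitive :: "real \<Rightarrow> real \<Rightarrow> real \<Rightarrow> real \<Rightarrow> real" where
  "quartic_primitive \<alpha> L t s = (t ^ 1 * (s ^ 4 - 4 * \<alpha> * s ^ 3 + 12 * \<alpha> ^ 2 * s ^ 2 - 24 * \<alpha> ^ 3 * s + 24 * \<alpha> ^ 4))
     + 4 * (- L) * (t ^ 2 * (1 / 2 * s ^ 3 - 3 * \<alpha> / 4 * s ^ 2 + 6 * \<alpha> ^ 2 / 8 * s - 6 * \<alpha> ^ 3 / 16))
     + 6 * (- L) ^ 2 * (t ^ 3 * (1 / 3 * s ^ 2 - 2 * \<alpha> / 9 * s + 2 * \<alpha> ^ 2 / 27))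
     + 4 * (- L) ^ 3 * (t ^ 4 * (1 / 4 * s - \<alpha> / 16))
     + (- L) ^ 4 * (t ^ 5 * (1 / 5))"

text \<open>Shows where the long expression comes from: it is a definite integral times 720, with s
  = R^2 L at t = R^2 and s = L at t = 1. Substituting R^2 = 2 \<alpha> + 1 leaves a polynomial
  identity in \<alpha> and L.\<close>

lemma kappa1_eq:
  fixes R :: real
  defines "\<alpha> \<equiv> (R\<^sup>2 - 1) / 2" and "L \<equiv> ln R"
  shows "kappa1 R = 720 * (quartic_primitive \<alpha> L (R\<^sup>2) (R\<^sup>2 * L) - quartic_primitive \<alpha> L 1 L)"
proof -
  have P: "R\<^sup>2 = 2 * \<alpha> + 1"
  proof -
    have "x = 2 * ((x - 1) / 2) + 1" for x :: real by (simp add: field_simps)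
    then show ?thesis unfolding \<alpha>_def .
  qed
  have pow: "R ^ 4 = (R\<^sup>2) ^ 2" "R ^ 6 = (R\<^sup>2) ^ 3" "R ^ 8 = (R\<^sup>2) ^ 4" "R ^ 10 = (R\<^sup>2) ^ 5"
    by (simp_all flip: power_mult)
  show ?thesis
    unfolding kappa1_def Let_def L_def[symmetric] pow unfolding P quartic_primitive_def
    by (simp add: algebra_simps)
      (simp add: algebra_simps eval_nat_numeral add_divide_distrib diff_divide_distrib)
qed

lemma torsion_quartic:
  assumes R: "1 < R"
  shows "integral {1..R\<^sup>2} (\<lambda>t. (torsion R t) ^ 4) = kappa1 R / 720"
proof (rule integral_unique)
  define L P where "L = ln R" and "P = R\<^sup>2"
  define \<alpha> where "\<alpha> = (P - 1) / 2"
  have P: "1 < P" using R by (simp add: P_def one_less_power)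
  have lP: "\<alpha> * ln P + L = P * L"
  proof -
    have "ln P = 2 * L" using R by (simp add: P_def L_def ln_realpow)
    moreover have "\<alpha> * (2 * L) = (P - 1) * L" by (simp add: \<alpha>_def)
    ultimately show ?thesis by (simp add: algebra_simps)
  qed
  define G where "G t = quartic_primitive \<alpha> L t (\<alpha> * ln t + L)" for t
  have "((\<lambda>t. (torsion R t) ^ 4) has_integral (G P - G 1)) {1..P}"
  proof (rule fundamental_theorem_of_calculus)
    fix t assume "t \<in> {1..P}"
    then have t: "t > 0" by simp
    define s where "s = \<alpha> * ln t + L"
    have s: "((\<lambda>t. \<alpha> * ln t + L) has_real_derivative \<alpha> / t) (at t)"
      using t by (auto intro!: derivative_eq_intros)
    \<comment> \<open>As ds/dt = \<alpha>/t, the derivative of t^n q(s) is t^(n-1) (n q + \<alpha>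
      q'). The polynomials below solve n q + \<alpha> q' = s^(5-n) for n = 1, ..., 5.\<close>
    have prim: "((\<lambda>t. t ^ n * q (\<alpha> * ln t + L)) has_real_derivative e) (at t)"
      if q: "(q has_real_derivative q') (at s)" and n: "n = Suc k"
        and e: "e = t ^ k * (real (Suc k) * q s + \<alpha> * q')" for q q' k n e
    proof -
      have "((\<lambda>t. q (\<alpha> * ln t + L)) has_real_derivative q' * (\<alpha> / t)) (at t)"
        by (rule DERIV_chain2[where f=q and g="\<lambda>t. \<alpha> * ln t + L", OF q[unfolded s_def] s])
      from DERIV_mult[OF DERIV_pow[of n] this]
      have "((\<lambda>t. t ^ n * q (\<alpha> * ln t + L)) has_real_derivative
          real n * t ^ (n - Suc 0) * q s + q' * (\<alpha> / t) * t ^ n) (at t)"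
        unfolding s_def .
      moreover have "real n * t ^ (n - Suc 0) * q s + q' * (\<alpha> / t) * t ^ n = e"
        unfolding n e using t by (simp add: distrib_left mult_ac)
      ultimately show ?thesis by simp
    qed
    have q0: "((\<lambda>s. s ^ 4 - 4 * \<alpha> * s ^ 3 + 12 * \<alpha> ^ 2 * s ^ 2 - 24 * \<alpha> ^ 3 * s + 24 * \<alpha> ^ 4) has_real_derivative 4 * s ^ 3 - 12 * \<alpha> * s ^ 2 + 24 * \<alpha> ^ 2 * s - 24 * \<alpha> ^ 3) (at s)"
      by (auto intro!: derivative_eq_intros)
    have d0: "((\<lambda>t. t ^ 1 * ((\<alpha> * ln t + L) ^ 4 - 4 * \<alpha> * (\<alpha> * ln t + L) ^ 3 + 12 * \<alpha> ^ 2 * (\<alpha> * ln t + L) ^ 2 - 24 * \<alpha> ^ 3 * (\<alpha> * ln t + L) + 24 * \<alpha> ^ 4)) has_real_derivative s ^ 4) (at t)"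
      by (rule prim[OF q0, where k=0]) (simp_all add: algebra_simps eval_nat_numeral)
    have q1: "((\<lambda>s. 1 / 2 * s ^ 3 - 3 * \<alpha> / 4 * s ^ 2 + 6 * \<alpha> ^ 2 / 8 * s - 6 * \<alpha> ^ 3 / 16) has_real_derivative 3 / 2 * s ^ 2 - 3 * \<alpha> / 2 * s + 6 * \<alpha> ^ 2 / 8) (at s)"
      by (auto intro!: derivative_eq_intros)
    have d1: "((\<lambda>t. t ^ 2 * (1 / 2 * (\<alpha> * ln t + L) ^ 3 - 3 * \<alpha> / 4 * (\<alpha> * ln t + L) ^ 2 + 6 * \<alpha> ^ 2 / 8 * (\<alpha> * ln t + L) - 6 * \<alpha> ^ 3 / 16)) has_real_derivative t * s ^ 3) (at t)"
      by (rule prim[OF q1, where k=1]) (simp_all add: algebra_simps eval_nat_numeral)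
    have q2: "((\<lambda>s. 1 / 3 * s ^ 2 - 2 * \<alpha> / 9 * s + 2 * \<alpha> ^ 2 / 27) has_real_derivative 2 / 3 * s - 2 * \<alpha> / 9) (at s)"
      by (auto intro!: derivative_eq_intros)
    have d2: "((\<lambda>t. t ^ 3 * (1 / 3 * (\<alpha> * ln t + L) ^ 2 - 2 * \<alpha> / 9 * (\<alpha> * ln t + L) + 2 * \<alpha> ^ 2 / 27)) has_real_derivative t ^ 2 * s ^ 2) (at t)"
      by (rule prim[OF q2, where k=2]) (simp_all add: algebra_simps eval_nat_numeral)
    have q3: "((\<lambda>s. 1 / 4 * s - \<alpha> / 16) has_real_derivative 1 / 4) (at s)"
      by (auto intro!: derivative_eq_intros)
    have d3: "((\<lambda>t. t ^ 4 * (1 / 4 * (\<alpha> * ln t + L) - \<alpha> / 16)) has_real_derivative t ^ 3 * s) (at t)"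
      by (rule prim[OF q3, where k=3]) (simp_all add: algebra_simps eval_nat_numeral)
    have q4: "((\<lambda>s. 1 / 5) has_real_derivative 0) (at s)"
      by (auto intro!: derivative_eq_intros)
    have d4: "((\<lambda>t. t ^ 5 * (1 / 5)) has_real_derivative t ^ 4) (at t)"
      by (rule prim[OF q4, where k=4]) (simp_all add: algebra_simps eval_nat_numeral)
    note d = d0 d1 d2 d3 d4
    have "(G has_real_derivative (s ^ 4) + 4 * (- L) * (t * s ^ 3) + 6 * (- L) ^ 2 * (t ^ 2 * s ^ 2) + 4 * (- L) ^ 3 * (t ^ 3 * s) + (- L) ^ 4 * (t ^ 4)) (at t)"
      unfolding G_def[abs_def] quartic_primitive_def by (intro DERIV_add DERIV_cmult d)
    \<comment> \<open>The binomial theorem reassembles the five terms.\<close>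
    moreover have "(s ^ 4) + 4 * (- L) * (t * s ^ 3) + 6 * (- L) ^ 2 * (t ^ 2 * s ^ 2) + 4 * (- L) ^ 3 * (t ^ 3 * s) + (- L) ^ 4 * (t ^ 4) = (s - L * t) ^ 4"
      by (simp add: algebra_simps eval_nat_numeral)
    moreover have "s - L * t = torsion R t"
      by (simp add: s_def torsion_def \<alpha>_def P_def L_def algebra_simps)
    ultimately show "(G has_vector_derivative (torsion R t) ^ 4) (at t within {1..P})"
      by (simp add: has_real_derivative_iff_has_vector_derivative has_vector_derivative_at_within)
  qed (use P in simp)
  moreover have "G P - G 1 = kappa1 R / 720"
  proof -
    have "G P = quartic_primitive \<alpha> L P (P * L)" "G 1 = quartic_primitive \<alpha> L 1 L"
      by (simp_all add: G_def lP)
    then show ?thesis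
      using kappa1_eq[of R] by (simp add: \<alpha>_def P_def L_def)
  qed
  ultimately show "((\<lambda>t. (torsion R t) ^ 4) has_integral kappa1 R / 720) {1..R\<^sup>2}"
    unfolding P_def by metis
qed

section \<open>Approximation of the torsion function by compactly supported C^1 functions\<close>

lemma DERIV_positive_part_sq:
  "((\<lambda>t::real. (max 0 (t - e))\<^sup>2) has_real_derivative 2 * max 0 (t - e)) (at t)"
proof (cases t e rule: linorder_cases)
  case less
  show ?thesis
    by (rule has_field_derivative_transform_within_open[where S="{..<e}" and f="\<lambda>_. 0"])
      (use less in \<open>auto simp: max_def\<close>)
next
  case greater
  show ?thesis
    by (rule has_field_derivative_transform_within_open[where S="{e<..}" and f="\<lambda>t. (t - e)\<^sup>2"])
      (use greater in \<open>auto simp: max_def intro!: derivative_eq_intros\<close>)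
next
  case equal
  \<comment> \<open>At the kink the difference quotient is \<open>max 0 h\<close> itself.\<close>
  have "((\<lambda>h::real. max 0 h) \<longlongrightarrow> max 0 0) (at 0)" by (intro tendsto_intros)
  then have "((\<lambda>h::real. max 0 h) \<longlongrightarrow> 0) (at 0)" by simp
  then have "((\<lambda>h. ((max 0 (t + h - e))\<^sup>2 - (max 0 (t - e))\<^sup>2) / h) \<longlongrightarrow> 0) (at 0)"
    by (rule Lim_transform_eventually)
      (auto simp: equal eventually_at_filter max_def power2_eq_square intro!: always_eventually)
  then show ?thesis by (simp add: DERIV_def equal)
qed

text \<open>\<open>cutoff e\<close> is a \<open>C\<^sup>1\<close> function on the positive axis vanishing on \<open>(0, e]\<close>; since
  the torsion function is positive in the annulus and zero on its boundary, composing with it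
  gives admissible test functions.\<close>

definition cutoff_ratio :: "real \<Rightarrow> real \<Rightarrow> real" where
  "cutoff_ratio e t = max 0 (t - e) / t"

definition cutoff :: "real \<Rightarrow> real \<Rightarrow> real" where
  "cutoff e t = (max 0 (t - e))\<^sup>2 / t"

text \<open>With r = \<open>cutoff_ratio e t\<close>, for t > 0 one has \<open>cutoff e t\<close> =
  r^2 t and \<open>cutoff' e t\<close> = 1 - (1 - r)^2. The error factors r^2 - 1 and -(1 - r)^2
  thus lie in [-1, 0] for e >= 0 and tend to 0 with e.\<close>

definition cutoff' :: "real \<Rightarrow> real \<Rightarrow> real" where
  "cutoff' e t = 2 * cutoff_ratio e t - (cutoff_ratio e t)\<^sup>2"

lemma DERIV_cutoff: "0 < t \<Longrightarrow> (cutoff e has_real_derivative cutoff' e t) (at t)"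
  unfolding cutoff_def[abs_def]
  by (rule DERIV_cong[OF DERIV_divide[OF DERIV_positive_part_sq DERIV_ident]])
    (auto simp: cutoff'_def cutoff_ratio_def power_divide diff_divide_distrib power2_eq_square)

lemma cutoff_ratio_range:
  "0 \<le> e \<Longrightarrow> 0 < t \<Longrightarrow> 0 \<le> cutoff_ratio e t \<and> cutoff_ratio e t \<le> 1"
  by (auto simp: cutoff_ratio_def)

lemma cutoff_ratio_tendsto:
  assumes "e \<longlonglongrightarrow> 0" "0 < t"
  shows "(\<lambda>n. cutoff_ratio (e n) t) \<longlonglongrightarrow> 1"
proof -
  have "(\<lambda>n. max 0 (t - e n) / t) \<longlonglongrightarrow> max 0 (t - 0) / t"
    using assms by (intro tendsto_intros) auto
  then show ?thesis using assms by (simp add: cutoff_ratio_def)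
qed

text \<open>Dominated convergence. Both the function error and the gradient error of the truncation
  are a bounded factor times a fixed L^2 function.\<close>

lemma weighted_L2_tendsto_0:
  fixes c :: "nat \<Rightarrow> 'a \<Rightarrow> real" and G :: "'a \<Rightarrow> real"
  assumes [measurable]: "A \<in> sets M" "\<And>n. c n \<in> borel_measurable M" "G \<in> borel_measurable M"
    and G: "set_integrable M A (\<lambda>x. (G x)\<^sup>2)"
    and c1: "\<And>n x. x \<in> A \<Longrightarrow> \<bar>c n x\<bar> \<le> 1"
    and c0: "\<And>x. x \<in> A \<Longrightarrow> (\<lambda>n. c n x) \<longlonglongrightarrow> 0"
  shows "(\<lambda>n. \<integral>\<^sup>+x\<in>A. ennreal ((c n x * G x)\<^sup>2) \<partial>M) \<longlonglongrightarrow> 0"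
proof -
  have "(\<lambda>n. \<integral>\<^sup>+x\<in>A. ennreal ((c n x * G x)\<^sup>2) \<partial>M) \<longlonglongrightarrow> (\<integral>\<^sup>+x. 0 \<partial>M)"
  proof (rule nn_integral_dominated_convergence[where w="\<lambda>x. ennreal ((G x)\<^sup>2) * indicator A x"])
    show "(\<integral>\<^sup>+x\<in>A. ennreal ((G x)\<^sup>2) \<partial>M) < \<infinity>"
      using set_nn_integral_eq_LINT[OF G] by simp
    fix n
    show "AE x in M. ennreal ((c n x * G x)\<^sup>2) * indicator A x \<le> ennreal ((G x)\<^sup>2) * indicator A x"
    proof (rule AE_I2)
      fix x
      show "ennreal ((c n x * G x)\<^sup>2) * indicator A x \<le> ennreal ((G x)\<^sup>2) * indicator A x"
      proof (cases "x \<in> A")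
        case True
        have "(c n x)\<^sup>2 \<le> 1" using c1[OF True, of n] by (simp add: abs_square_le_1)
        then have "(c n x)\<^sup>2 * (G x)\<^sup>2 \<le> 1 * (G x)\<^sup>2" by (rule mult_right_mono) simp
        then show ?thesis using True by (simp add: power_mult_distrib ennreal_leI)
      qed simp
    qed
  next
    show "AE x in M. (\<lambda>n. ennreal ((c n x * G x)\<^sup>2) * indicator A x) \<longlonglongrightarrow> 0"
    proof (rule AE_I2)
      fix x
      show "(\<lambda>n. ennreal ((c n x * G x)\<^sup>2) * indicator A x) \<longlonglongrightarrow> 0"
      proof (cases "x \<in> A")
        case True
        have "(\<lambda>n. ennreal ((c n x * G x)\<^sup>2)) \<longlonglongrightarrow> ennreal ((0 * G x)\<^sup>2)"
          using c0[OF True] by (intro tendsto_ennrealI tendsto_intros)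
        then show ?thesis using True by simp
      qed simp
    qed
  qed measurable
  then show ?thesis by simp
qed

text \<open>The approximants are \<open>cutoff (e n)\<close> of the torsion function, extended by
  zero; their supports lie in superlevel sets of the torsion function.\<close>

lemma torsion_H10:
  assumes R: "1 < R"
  shows "H10 R (\<lambda>x. torsion R ((norm x)\<^sup>2)) (\<lambda>i x. 2 * torsion' R ((norm x)\<^sup>2) * (x \<bullet> i))"
proof -
  note oO = open_Omega[of R]
  have Os [measurable]: "Omega R \<in> sets lebesgue" using Omega_sets by simp
  note range = norm_sq_Omega[OF R]
  have pos: "0 < torsion R ((norm x)\<^sup>2)" if "x \<in> Omega R" for x
    using range[OF that] by (intro torsion_pos R)
  have leb: "f \<in> borel_measurable lebesgue" if "f \<in> borel_measurable borel" for f :: "real^2 \<Rightarrow> real"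
    using that by (intro measurable_completion) simp
  define e where "e n = inverse (real (Suc n))" for n
  have e0: "e n > 0" for n by (simp add: e_def)
  have elim: "e \<longlonglongrightarrow> 0" unfolding e_def by (rule LIMSEQ_inverse_real_of_nat)
  define v where "v x = torsion R ((norm x)\<^sup>2)" for x :: "real^2"
  define g where "g i x = 2 * torsion' R ((norm x)\<^sup>2) * (x \<bullet> i)" for i x :: "real^2"
  define \<phi> where "\<phi> n x = (if x \<in> Omega R then cutoff (e n) (v x) else 0)" for n and x :: "real^2"
  define D where "D n x h = (if x \<in> Omega R then cutoff' (e n) (v x) * g h x else 0)" for n and x h :: "real^2"
  define A where "A = {x :: real^2. 1 \<le> norm x \<and> norm x \<le> R}"
  \<comment> \<open>The superlevel set is taken in the closed annulus, which makes it compact; the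
    zero boundary values keep it inside the open one.\<close>
  define K where "K n = A \<inter> v -` {e n..}" for n
  have vA: "continuous_on A v"
    unfolding v_def[abs_def] torsion_def by (intro continuous_intros) (auto simp: A_def)
  have clA: "closed A"
    unfolding A_def by (intro closed_Collect_conj closed_Collect_le continuous_intros)
  have clK: "closed (K n)" for n
    unfolding K_def by (rule continuous_closed_preimage[OF vA clA]) simp
  have KO: "K n \<subseteq> Omega R" for n
  proof
    fix x assume "x \<in> K n"
    then have x: "1 \<le> norm x" "norm x \<le> R" "v x > 0" using e0[of n] by (auto simp: K_def A_def)
    then have "norm x \<noteq> 1" "norm x \<noteq> R" using torsion_ends[OF R] by (auto simp: v_def)
    then show "x \<in> Omega R" using x by (auto simp: Omega_def)
  qed
  have offK: "cutoff (e n) (v x) = 0" "cutoff' (e n) (v x) = 0" if "x \<in> Omega R" "x \<notin> K n" for n x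
  proof -
    have "v x < e n" using that by (auto simp: K_def A_def Omega_def)
    then show "cutoff (e n) (v x) = 0" "cutoff' (e n) (v x) = 0"
      by (simp_all add: cutoff_def cutoff'_def cutoff_ratio_def)
  qed
  have supp: "closure {x. \<phi> n x \<noteq> 0} \<subseteq> K n" for n
    using offK clK by (intro closure_minimal) (auto simp: \<phi>_def)
  have compact: "compact (closure {x. \<phi> n x \<noteq> 0})" for n
  proof -
    have "bounded (K n)" by (auto simp: K_def A_def bounded_iff)
    then show ?thesis using supp bounded_subset compact_eq_bounded_closed closed_closure by metis
  qed
  have deriv: "(\<phi> n has_derivative D n x) (at x)" for n x
  proof (cases "x \<in> Omega R")
    case True
    define t where "t = (norm x)\<^sup>2"
    have t: "0 < t" "0 < torsion R t" using range[OF True] pos[OF True] by (auto simp: t_def)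
    have "((\<lambda>t. cutoff (e n) (torsion R t)) has_real_derivative
        cutoff' (e n) (torsion R t) * torsion' R t) (at t)"
      by (rule DERIV_chain2[where f="cutoff (e n)" and g="torsion R"])
        (use t in \<open>auto intro: DERIV_cutoff DERIV_torsion\<close>)
    then have 1: "((\<lambda>t. cutoff (e n) (torsion R t)) has_derivative
        (\<lambda>h. cutoff' (e n) (torsion R t) * torsion' R t * h)) (at ((norm x)\<^sup>2))"
      by (simp add: has_field_derivative_def t_def)
    have 2: "((\<lambda>y. (norm y)\<^sup>2) has_derivative (\<lambda>h. 2 * (x \<bullet> h))) (at x)"
      unfolding power2_norm_eq_inner
      by (rule has_derivative_eq_rhs[OF has_derivative_inner[OF has_derivative_ident has_derivative_ident]])
        (auto simp: inner_commute)
    have "((\<lambda>y. cutoff (e n) (v y)) has_derivative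
        (\<lambda>h. cutoff' (e n) (torsion R t) * torsion' R t * (2 * (x \<bullet> h)))) (at x)"
      using has_derivative_compose[OF 2 1] by (simp add: v_def)
    then have "(\<phi> n has_derivative
        (\<lambda>h. cutoff' (e n) (torsion R t) * torsion' R t * (2 * (x \<bullet> h)))) (at x)"
      by (rule has_derivative_transform_within_open[OF _ oO True]) (simp add: \<phi>_def)
    moreover have "(\<lambda>h. cutoff' (e n) (torsion R t) * torsion' R t * (2 * (x \<bullet> h))) = D n x"
      using True by (auto simp: D_def g_def v_def t_def fun_eq_iff)
    ultimately show ?thesis by simp
  next
    case False
    then have "x \<in> - K n" using KO by auto
    then have "(\<phi> n has_derivative (\<lambda>_. 0)) (at x)"
      using offK
      by (intro has_derivative_transform_within_open[OF has_derivative_const[of 0] open_Compl[OF clK]])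
        (auto simp: \<phi>_def)
    moreover have "D n x = (\<lambda>_. 0)" using False by (auto simp: D_def)
    ultimately show ?thesis by simp
  qed
  have vO: "continuous_on (Omega R) v"
    by (rule continuous_on_subset[OF vA]) (auto simp: A_def Omega_def)
  have gO: "continuous_on (Omega R) (g i)" for i
    unfolding g_def[abs_def] torsion'_def by (intro continuous_intros) (auto simp: Omega_def)
  have ratio: "continuous_on (Omega R) (\<lambda>x. cutoff_ratio (e n) (v x))" for n
    unfolding cutoff_ratio_def using pos by (intro continuous_intros vO) (auto simp: v_def less_imp_neq[THEN not_sym])
  have Dcont: "continuous_on UNIV (\<lambda>x. D n x i)" for n i
  proof -
    \<comment> \<open>The explicit formula on the annulus and zero off \<open>K n\<close> are glued
      over two open sets.\<close>
    have U: "UNIV = Omega R \<union> - K n" using KO by auto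
    show ?thesis unfolding U
    proof (rule continuous_on_open_Un[OF oO open_Compl[OF clK]])
      have "continuous_on (Omega R) (\<lambda>x. cutoff' (e n) (v x) * g i x)"
        unfolding cutoff'_def by (intro continuous_intros ratio gO)
      then show "continuous_on (Omega R) (\<lambda>x. D n x i)"
        by (rule continuous_on_eq) (simp add: D_def)
      show "continuous_on (- K n) (\<lambda>x. D n x i)"
        by (rule continuous_on_eq[of _ "\<lambda>_. 0"]) (auto simp: D_def offK)
    qed
  qed
  have vm: "v \<in> borel_measurable borel" and gm: "g i \<in> borel_measurable borel" for i
    unfolding v_def[abs_def] g_def[abs_def] torsion_def torsion'_def by measurable
  have ratio_m: "(\<lambda>x. cutoff_ratio (e n) (v x)) \<in> borel_measurable borel" for n
    unfolding cutoff_ratio_def using vm by measurable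
  have ratio01: "0 \<le> cutoff_ratio (e n) (v x) \<and> cutoff_ratio (e n) (v x) \<le> 1" if "x \<in> Omega R" for n x
    using e0[of n] pos[OF that] by (intro cutoff_ratio_range) (auto simp: v_def)
  have ratio_lim: "(\<lambda>n. cutoff_ratio (e n) (v x)) \<longlonglongrightarrow> 1" if "x \<in> Omega R" for x
    using pos[OF that] by (intro cutoff_ratio_tendsto elim) (auto simp: v_def)
  have vi: "set_integrable lebesgue (Omega R) (\<lambda>x. (v x)\<^sup>2)"
    unfolding v_def torsion_def
    by (rule radial_integral(1)[OF R]) (auto intro!: continuous_intros)
  \<comment> \<open>A single partial derivative is not radial, so it is dominated by the full
    squared gradient, which is.\<close>
  have gi: "set_integrable lebesgue (Omega R) (\<lambda>x. (g i x)\<^sup>2)" if "i \<in> Basis" for i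
  proof (rule set_integrable_bound)
    show "set_integrable lebesgue (Omega R) (\<lambda>x. 4 * (torsion' R ((norm x)\<^sup>2))\<^sup>2 * (norm x)\<^sup>2)"
      unfolding torsion'_def
      by (rule radial_integral(1)[OF R, of "\<lambda>t. 4 * ((R\<^sup>2 - 1) / 2 / t - ln R)\<^sup>2 * t"])
        (auto intro!: continuous_intros)
    show "set_borel_measurable lebesgue (Omega R) (\<lambda>x. (g i x)\<^sup>2)"
      unfolding set_borel_measurable_def using leb[OF gm[of i]] by measurable
    show "AE x in lebesgue. x \<in> Omega R \<longrightarrow> norm ((g i x)\<^sup>2) \<le>
        norm (4 * (torsion' R ((norm x)\<^sup>2))\<^sup>2 * (norm x)\<^sup>2)"
    proof (intro AE_I2 impI)
      fix x :: "real^2"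
      have "(x \<bullet> i)\<^sup>2 \<le> (norm x)\<^sup>2"
        using power_mono[OF Basis_le_norm[OF that, of x], of 2] by simp
      then have "4 * (torsion' R ((norm x)\<^sup>2))\<^sup>2 * (x \<bullet> i)\<^sup>2 \<le> 4 * (torsion' R ((norm x)\<^sup>2))\<^sup>2 * (norm x)\<^sup>2"
        by (intro mult_left_mono) auto
      then show "norm ((g i x)\<^sup>2) \<le> norm (4 * (torsion' R ((norm x)\<^sup>2))\<^sup>2 * (norm x)\<^sup>2)"
        by (simp add: g_def power_mult_distrib abs_mult)
    qed
  qed
  have lim_v: "(\<lambda>n. \<integral>\<^sup>+x\<in>Omega R. ennreal ((norm (\<phi> n x - v x))\<^sup>2) \<partial>lebesgue) \<longlonglongrightarrow> 0"
  proof -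
    have "(\<lambda>n. \<integral>\<^sup>+x\<in>Omega R. ennreal ((((cutoff_ratio (e n) (v x))\<^sup>2 - 1) * v x)\<^sup>2) \<partial>lebesgue) \<longlonglongrightarrow> 0"
    proof (rule weighted_L2_tendsto_0[OF Os _ leb[OF vm] vi])
      show "(\<lambda>x. (cutoff_ratio (e n) (v x))\<^sup>2 - 1) \<in> borel_measurable lebesgue" for n
        using leb[OF ratio_m[of n]] by measurable
      fix x assume x: "x \<in> Omega R"
      show "\<bar>(cutoff_ratio (e n) (v x))\<^sup>2 - 1\<bar> \<le> 1" for n
        using ratio01[OF x, of n] power_le_one[of "cutoff_ratio (e n) (v x)" 2] by (auto simp: abs_le_iff)
      have "(\<lambda>n. (cutoff_ratio (e n) (v x))\<^sup>2 - 1) \<longlonglongrightarrow> 1\<^sup>2 - 1"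
        by (intro tendsto_intros ratio_lim x)
      then show "(\<lambda>n. (cutoff_ratio (e n) (v x))\<^sup>2 - 1) \<longlonglongrightarrow> 0" by simp
    qed
    moreover have "(\<integral>\<^sup>+x\<in>Omega R. ennreal ((norm (\<phi> n x - v x))\<^sup>2) \<partial>lebesgue) =
        (\<integral>\<^sup>+x\<in>Omega R. ennreal ((((cutoff_ratio (e n) (v x))\<^sup>2 - 1) * v x)\<^sup>2) \<partial>lebesgue)" for n
    proof (intro nn_integral_cong)
      fix x
      have "\<phi> n x - v x = ((cutoff_ratio (e n) (v x))\<^sup>2 - 1) * v x" if "x \<in> Omega R"
        using that pos[OF that]
        by (simp add: \<phi>_def cutoff_def cutoff_ratio_def v_def[symmetric] left_diff_distrib power_divide power2_eq_square)
      then show "ennreal ((norm (\<phi> n x - v x))\<^sup>2) * indicator (Omega R) x =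
          ennreal ((((cutoff_ratio (e n) (v x))\<^sup>2 - 1) * v x)\<^sup>2) * indicator (Omega R) x"
        by (cases "x \<in> Omega R") auto
    qed
    ultimately show ?thesis by simp
  qed
  have lim_g: "(\<lambda>n. \<integral>\<^sup>+x\<in>Omega R. ennreal ((norm (D n x i - g i x))\<^sup>2) \<partial>lebesgue) \<longlonglongrightarrow> 0"
    if i: "i \<in> Basis" for i
  proof -
    have "(\<lambda>n. \<integral>\<^sup>+x\<in>Omega R. ennreal (((- (1 - cutoff_ratio (e n) (v x))\<^sup>2) * g i x)\<^sup>2) \<partial>lebesgue) \<longlonglongrightarrow> 0"
    proof (rule weighted_L2_tendsto_0[OF Os _ leb[OF gm] gi[OF i]])
      show "(\<lambda>x. - (1 - cutoff_ratio (e n) (v x))\<^sup>2) \<in> borel_measurable lebesgue" for n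
        using leb[OF ratio_m[of n]] by measurable
      fix x assume x: "x \<in> Omega R"
      show "\<bar>- (1 - cutoff_ratio (e n) (v x))\<^sup>2\<bar> \<le> 1" for n
        using ratio01[OF x, of n] power_le_one[of "1 - cutoff_ratio (e n) (v x)" 2] by simp
      have "(\<lambda>n. - (1 - cutoff_ratio (e n) (v x))\<^sup>2) \<longlonglongrightarrow> - (1 - 1)\<^sup>2"
        by (intro tendsto_intros ratio_lim x)
      then show "(\<lambda>n. - (1 - cutoff_ratio (e n) (v x))\<^sup>2) \<longlonglongrightarrow> 0" by simp
    qed
    moreover have "(\<integral>\<^sup>+x\<in>Omega R. ennreal ((norm (D n x i - g i x))\<^sup>2) \<partial>lebesgue) =
        (\<integral>\<^sup>+x\<in>Omega R. ennreal (((- (1 - cutoff_ratio (e n) (v x))\<^sup>2) * g i x)\<^sup>2) \<partial>lebesgue)" for n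
    proof (intro nn_integral_cong)
      fix x
      have "D n x i - g i x = (- (1 - cutoff_ratio (e n) (v x))\<^sup>2) * g i x" if "x \<in> Omega R"
        using that by (simp add: D_def cutoff'_def algebra_simps power2_eq_square)
      then show "ennreal ((norm (D n x i - g i x))\<^sup>2) * indicator (Omega R) x =
          ennreal (((- (1 - cutoff_ratio (e n) (v x))\<^sup>2) * g i x)\<^sup>2) * indicator (Omega R) x"
        by (cases "x \<in> Omega R") auto
    qed
    ultimately show ?thesis by simp
  qed
  have "H10 R v g"
    unfolding H10_def
  proof (intro conjI exI[of _ \<phi>] exI[of _ D] allI ballI)
    fix n
    show "closure {x. \<phi> n x \<noteq> 0} \<subseteq> Omega R" using supp KO by blast
  qed (use leb[OF vm] leb[OF gm] deriv Dcont compact lim_v lim_g in auto)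
  then show ?thesis by (simp add: v_def[abs_def] g_def[abs_def])
qed

section \<open>The Rayleigh quotient of the torsion function and the final bounds\<close>

text \<open>Only the sum of the squared partial derivatives is radial, so the sum is moved under the
  integral before reduction to one variable.\<close>

lemma torsion_grad_sq:
  assumes R: "1 < R"
  shows "grad_sq R (\<lambda>i x. 2 * torsion' R ((norm x)\<^sup>2) * (x \<bullet> i)) =
    2 * pi * (((R\<^sup>2 + 1) * ln R + 1 - R\<^sup>2) * (R\<^sup>2 - 1) * ln R)"
proof -
  define h where "h i x = (norm (2 * torsion' R ((norm x)\<^sup>2) * (x \<bullet> i)))\<^sup>2" for i x :: "real^2"
  have [measurable]: "Omega R \<in> sets lebesgue" using Omega_sets by simp
  have F: "(\<lambda>t. 4 * (torsion' R t)\<^sup>2 * t) \<in> borel_measurable borel"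
    "continuous_on {1..R\<^sup>2} (\<lambda>t. 4 * (torsion' R t)\<^sup>2 * t)"
    unfolding torsion'_def by (auto intro!: continuous_intros)
  have tot: "(\<Sum>i\<in>Basis. h i x) = 4 * (torsion' R ((norm x)\<^sup>2))\<^sup>2 * (norm x)\<^sup>2" for x
  proof -
    have "(\<Sum>i\<in>Basis. (norm (2 * k * (x \<bullet> i)))\<^sup>2) = 4 * k\<^sup>2 * (norm x)\<^sup>2" for k
      unfolding power2_norm_eq_inner[of x] euclidean_inner[of x x]
      by (simp add: power_mult_distrib sum_distrib_left power2_eq_square mult_ac)
    then show ?thesis unfolding h_def .
  qed
  have hi: "set_integrable lebesgue (Omega R) (h i)" if "i \<in> Basis" for i
  proof (rule set_integrable_bound[OF radial_integral(1)[OF R F]])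
    have "h i \<in> borel_measurable borel" unfolding h_def[abs_def] torsion'_def by measurable
    then have "h i \<in> borel_measurable lebesgue" by (intro measurable_completion) simp
    then show "set_borel_measurable lebesgue (Omega R) (h i)"
      unfolding set_borel_measurable_def by measurable
    have "h i x \<le> (\<Sum>i\<in>Basis. h i x)" for x
      using that by (intro member_le_sum) (auto simp: h_def)
    then show "AE x in lebesgue. x \<in> Omega R \<longrightarrow> norm (h i x) \<le>
        norm (4 * (torsion' R ((norm x)\<^sup>2))\<^sup>2 * (norm x)\<^sup>2)"
      unfolding tot by (auto simp: h_def)
  qed
  have "grad_sq R (\<lambda>i x. 2 * torsion' R ((norm x)\<^sup>2) * (x \<bullet> i)) =
      (\<Sum>i\<in>Basis. LINT x:Omega R|lebesgue. h i x)"
    by (simp add: grad_sq_def h_def)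
  also have "\<dots> = (LINT x:Omega R|lebesgue. (\<Sum>i\<in>Basis. h i x))"
    using hi unfolding set_lebesgue_integral_def set_integrable_def scaleR_sum_right
    by (subst Bochner_Integration.integral_sum) auto
  also have "\<dots> = pi * integral {1..R\<^sup>2} (\<lambda>t. 4 * (torsion' R t)\<^sup>2 * t)"
    unfolding tot by (rule radial_integral(2)[OF R F])
  finally show ?thesis unfolding torsion_energy[OF R] by simp
qed

lemma torsion_L4_sq:
  assumes R: "1 < R"
  shows "L4_sq R (\<lambda>x. torsion R ((norm x)\<^sup>2)) = sqrt (pi * kappa1 R / 720)"
proof -
  have "(LINT x:Omega R|lebesgue. (torsion R ((norm x)\<^sup>2)) ^ 4) = pi * integral {1..R\<^sup>2} (\<lambda>t. (torsion R t) ^ 4)"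
    unfolding torsion_def by (rule radial_integral(2)[OF R]) (auto intro!: continuous_intros)
  then show ?thesis by (simp add: L4_sq_def torsion_quartic[OF R])
qed

text \<open>A nonintegrable |w|^4 would have integral 0 by default, and a quotient with denominator
  0 would itself be 0. Positivity excludes such spurious values from \<open>S4\<close>.\<close>

lemma L4_sq_pos:
  fixes w :: "real^2 \<Rightarrow> 'b::euclidean_space"
  assumes i: "set_integrable lebesgue (Omega R) (\<lambda>x. (norm (w x)) ^ 4)"
    and n: "\<not> (AE x in lebesgue. x \<in> Omega R \<longrightarrow> w x = 0)"
  shows "0 < L4_sq R w"
proof -
  have "(LINT x:Omega R|lebesgue. (norm (w x)) ^ 4) \<noteq> 0"
  proof
    assume "(LINT x:Omega R|lebesgue. (norm (w x)) ^ 4) = 0"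
    then have "AE x in lebesgue. indicator (Omega R) x *\<^sub>R (norm (w x)) ^ 4 = 0"
      using i unfolding set_lebesgue_integral_def set_integrable_def
      by (subst (asm) integral_nonneg_eq_0_iff_AE) auto
    then have "AE x in lebesgue. x \<in> Omega R \<longrightarrow> w x = 0" by eventually_elim auto
    then show False using n by simp
  qed
  moreover have "0 \<le> (LINT x:Omega R|lebesgue. (norm (w x)) ^ 4)"
    unfolding set_lebesgue_integral_def by (intro integral_nonneg_AE) auto
  ultimately show ?thesis by (simp add: L4_sq_def)
qed

text \<open>Makes the torsion function admissible in \<open>S4\<close>: it is positive on an annulus
  of area pi (R^2 - 1) > 0.\<close>

lemma torsion_not_AE_0:
  assumes R: "1 < R"
  shows "\<not> (AE x in lebesgue. x \<in> Omega R \<longrightarrow> torsion R ((norm x)\<^sup>2) = 0)"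
proof
  assume "AE x in lebesgue. x \<in> Omega R \<longrightarrow> torsion R ((norm x)\<^sup>2) = 0"
  then have "AE x in lebesgue. x \<notin> Omega R"
  proof eventually_elim
    case (elim x)
    show ?case
    proof
      assume x: "x \<in> Omega R"
      then show False using torsion_pos[OF R norm_sq_Omega[OF R x]] elim by simp
    qed
  qed
  then have "(LINT x:Omega R|lebesgue. (1::real)) = 0"
    unfolding set_lebesgue_integral_def by (intro integral_eq_zero_AE) (auto elim: eventually_mono)
  moreover have "(LINT x:Omega R|lebesgue. (1::real)) = pi * integral {1..R\<^sup>2} (\<lambda>_. 1)"
    using radial_integral(2)[OF R, of "\<lambda>_. 1"] by simp
  ultimately show False using R by (simp add: one_less_power less_imp_le less_imp_neq[THEN not_sym])
qed

text \<open>Integrability of |w|^4 accompanies each bound, because the default value 0 of an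
  undefined integral would make the bound empty.\<close>

theorem theoremA2:
  fixes R :: real
  assumes "R > 1"
  shows "(\<forall>(w :: real^2 \<Rightarrow> real) g. H10 R w g \<longrightarrow>
            set_integrable lebesgue (Omega R) (\<lambda>x. (norm (w x)) ^ 4) \<and>
            L4_sq R w \<le> (1 / mu0) * sqrt (2 / (3 * pi) * (R\<^sup>2 - 1)) * grad_sq R g)
       \<and> (\<forall>(w :: real^2 \<Rightarrow> real^2) g. H10 R w g \<longrightarrow>
            set_integrable lebesgue (Omega R) (\<lambda>x. (norm (w x)) ^ 4) \<and>
            L4_sq R w \<le> (1 / mu0) * sqrt (2 / (3 * pi) * (R\<^sup>2 - 1)) * grad_sq R g)
       \<and> mu0 * sqrt (3 * pi / (2 * (R\<^sup>2 - 1))) \<le> S4 R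
       \<and> S4 R \<le> 24 * sqrt (5 * pi) *
            (((R\<^sup>2 + 1) * ln R + 1 - R\<^sup>2) * (R\<^sup>2 - 1) * ln R) / sqrt (kappa1 R)"
proof -
  define Q where "Q = {grad_sq R g / L4_sq R v | (v :: real^2 \<Rightarrow> real) g.
                 H10 R v g \<and> \<not> (AE x in lebesgue. x \<in> Omega R \<longrightarrow> v x = 0)}"
  define b where "b = mu0 * sqrt (3 * pi / (2 * (R\<^sup>2 - 1)))"
  define V where "V = (\<lambda>x :: real^2. torsion R ((norm x)\<^sup>2))"
  define W where "W = (\<lambda>i x :: real^2. 2 * torsion' R ((norm x)\<^sup>2) * (x \<bullet> i))"
  have R2: "1 < R\<^sup>2" using assms by (simp add: one_less_power)
  \<comment> \<open>The embedding constant is the reciprocal of the lower bound for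
    \<open>S4\<close>.\<close>
  have b: "(1 / mu0) * sqrt (2 / (3 * pi) * (R\<^sup>2 - 1)) = 1 / b" "0 < b"
    using R2 mu0_pos by (auto simp: b_def real_sqrt_divide real_sqrt_mult divide_simps)
  have lower: "b \<le> q" if "q \<in> Q" for q
  proof -
    from that obtain v :: "real^2 \<Rightarrow> real" and g where q: "q = grad_sq R g / L4_sq R v"
      and H: "H10 R v g" and n: "\<not> (AE x in lebesgue. x \<in> Omega R \<longrightarrow> v x = 0)"
      unfolding Q_def by blast
    have "0 < L4_sq R v" using H10_quartic_bound(1)[OF assms H] n by (rule L4_sq_pos)
    then show ?thesis using H10_L4_bound[OF assms H] b unfolding q b(1) by (simp add: field_simps)
  qed
  \<comment> \<open>Used twice: it makes the set nonempty, so that \<open>lower\<close> bounds the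
    infimum from below, and it bounds the infimum from above.\<close>
  have VQ: "grad_sq R W / L4_sq R V \<in> Q"
    unfolding Q_def V_def W_def using torsion_H10[OF assms] torsion_not_AE_0[OF assms] by blast
  have lo: "b \<le> S4 R"
    unfolding S4_def Q_def[symmetric] using VQ lower by (intro cInf_greatest) auto
  have up: "S4 R \<le> grad_sq R W / L4_sq R V"
    unfolding S4_def Q_def[symmetric] using VQ lower by (intro cInf_lower bdd_belowI) auto
  have eq: "grad_sq R W / L4_sq R V = 24 * sqrt (5 * pi) *
            (((R\<^sup>2 + 1) * ln R + 1 - R\<^sup>2) * (R\<^sup>2 - 1) * ln R) / sqrt (kappa1 R)"
  proof -
    define a where "a = ((R\<^sup>2 + 1) * ln R + 1 - R\<^sup>2) * (R\<^sup>2 - 1) * ln R"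
    \<comment> \<open>The factor 720 from the quartic integral, together with 2 pi from the energy,
      becomes 24 sqrt (5 pi).\<close>
    have "sqrt 720 = 12 * sqrt 5"
      using real_sqrt_mult[of 144 5] real_sqrt_abs[of 12] by simp
    then have "2 * pi / sqrt (pi * k / 720) = 24 * sqrt (5 * pi) / sqrt k" for k
      by (simp add: real_sqrt_divide real_sqrt_mult real_div_sqrt divide_simps)
    from arg_cong[OF this, of "\<lambda>z. z * a"] show ?thesis
      unfolding W_def V_def torsion_grad_sq[OF assms] torsion_L4_sq[OF assms] a_def
      by simp
  qed
  show ?thesis
    using lo up[unfolded eq]
    by (intro conjI allI impI H10_quartic_bound(1)[OF assms] H10_L4_bound[OF assms])
      (simp_all only: b_def)
qed

end
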